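(* For any $n,m\ge1$, trees $s\in Y_n$, $t\in Y_m$, and $1\le i\le n$, $$M_s\circ_iM_t=\sum_{B_i(s,t)\le r\le T_i(s,t)}M_r ,$$ where the sum is over all $r\in Y_{n+m-1}$ in the indicated interval of the Tamari order.
   Context: $\Bbbk$ is a commutative ring. $[n]=\{1,\dots,n\}$; $[a,b]$ denotes an interval of integers (empty if $a>b$). For a sequence $a$ of $n$ distinct integers, $\{a\}$ is its underlying set and $\mathrm{st}(a)\in S_n$ is the unique permutation with $\mathrm{st}(a)_p<\mathrm{st}(a)_q\iff a_p<a_q$. Permutations are written as lists of values. The weak order on $S_n$: $\sigma\le\tau$ iff $\mathrm{Inv}(\sigma)\subseteq\mathrm{Inv}(\tau)$, where $\mathrm{Inv}(\sigma)=\{(p,q):p<q,\sigma_p>\sigma_q\}$. Trees. $Y_n$ is the set of rooted planar binary trees with $n$ internal nodes ($n+1$ leaves); $|t|=n$ for $t\in Y_n$; $1_0$ is the unique element of $Y_0$. The grafting $s\vee t$ joins a new root to the roots of $s$ (left) and $t$ (right); each $t\in Y_n$, $n\ge1$, is uniquely $t=t_l\vee t_r$. $s\backslash t$: glue the root of $t$ to the rightmost branch of $s$ ($1_0\backslash t=t$, $s\backslash t=s_l\vee(s_r\backslash t)$); $s/t$: glue the root of $s$ to the leftmost branch of $t$ ($s/1_0=s$, $s/t=(s/t_l)\vee t_r$). Operad $\mathcal Y$. For $s\in Y_n$, $t\in Y_m$, $1\le i\le n$, put $j:=|s_l|+1$ and define $B_i(s,t)\in Y_{n+m-1}$ recursively: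 $B_i(s,t)=s_l\vee B_{i-j}(s_r,t)$ if $j<i$; $(s_l/t_l)\vee(t_r\backslash s_r)$ if $j=i$; $B_i(s_l,t)\vee s_r$ if $j>i$. $\Bbbk Y_n$ has basis $\{F_t\}_{t\in Y_n}$ and $\circ_i:\Bbbk Y_n\otimes\Bbbk Y_m\to\Bbbk Y_{n+m-1}$ is linear with $F_s\circ_iF_t:=F_{B_i(s,t)}$. Tamari order and $M$ basis. The Tamari order on $Y_n$ is the partial order whose relations are generated by $s\le t$ whenever $t$ is obtained from $s$ by replacing some subtree of the form $(a\vee b)\vee c$ by $a\vee(b\vee c)$. With $\mu$ its Möbius function, $M_s:=\sum_{s\le t}\mu(s,t)F_t$. Maps. $\gamma:Y_n\to S_n$: $\gamma(1_0)$ is the empty permutation and, for $t=t_l\vee t_r\in Y_n$ with $p=|t_l|$, $q=|t_r|$, $\gamma(t)=(\gamma(t_l)_1+q,\dots,\gamma(t_l)_p+q,\,n,\,\gamma(t_r)_1,\dots,\gamma(t_r)_q)$. $\varrho:S_n\to Y_n$ is the right adjoint of $\gamma$: $\varrho(\tau)$ is the unique tree such that for all $r\in Y_n$, $\gamma(r)\le\tau$ (weak order) $\iff r\le\varrho(\tau)$ (Tamari order); such a tree is known to exist. $T_i:S_n\times S_m\to S_{n+m-1}$. First, $B_i(\sigma,\tau):=(a_1,\dots,a_{i-1},b_1,\dots,b_m,a_{i+1},\dots,a_n)$ with $a_j=\sigma_j$ if $\sigma_j<\sigma_i$, $a_j=\sigma_j+m-1$ if $\sigma_j>\sigma_i$,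 $b_k=\tau_k+\sigma_i-1$. For $\rho\in S_{n+m-1}$ let $\mathcal L_1(\rho)=(\rho_1,\dots,\rho_{i-1})$, $\mathcal L_2(\rho)=(\rho_i,\dots,\rho_{i+m-1})$, $\mathcal L_3(\rho)=(\rho_{i+m},\dots,\rho_{n+m-1})$. If $m=1$, $T_i(\sigma,1):=\sigma$. If $m>1$, let $L_j:=\mathcal L_j(B_i(\sigma,\tau))$, $\eta_i:=\sigma_i+m-1$, $k_\sigma:=\max\{j\in[0,i-1]:[\sigma_i-j,\sigma_i]\subseteq\{L_1\}\cup\{\sigma_i\}\}$, $l_\sigma:=\max\{j\in[0,n-i]:[\eta_i,\eta_i+j]\subseteq\{\eta_i\}\cup\{L_3\}\}$, $A_{1,b}^\sigma:=\{x\in\{L_1\}:x<\sigma_i-k_\sigma\}$, $A_{1,t}^\sigma:=\{x\in\{L_1\}:x>\sigma_i\}$, $A_{3,b}^\sigma:=\{x\in\{L_3\}:x<\eta_i\}$, $A_{3,t}^\sigma:=\{x\in\{L_3\}:x>\eta_i+l_\sigma\}$. Then $T_i(\sigma,\tau)$ is the unique permutation whose sequences $L'_j:=\mathcal L_j(T_i(\sigma,\tau))$ satisfy $\mathrm{st}(L'_j)=\mathrm{st}(L_j)$ ($j=1,2,3$) and $\{L'_1\}=A_{1,b}^\sigma\cup[\eta_i+l_\sigma-k_\sigma,\eta_i+l_\sigma-1]\cup A_{1,t}^\sigma$, $\{L'_2\}=\{\sigma_i-k_\sigma\}\cup[\sigma_i-k_\sigma+l_\sigma+1,\eta_i+l_\sigma-k_\sigma-1]\cup\{\eta_i+l_\sigma\}$,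 $\{L'_3\}=A_{3,b}^\sigma\cup[\sigma_i-k_\sigma+1,\sigma_i-k_\sigma+l_\sigma]\cup A_{3,t}^\sigma$. $T_i:Y_n\times Y_m\to Y_{n+m-1}$ is defined by $T_i(s,t):=\varrho\bigl(T_i(\gamma(s),\gamma(t))\bigr)$. *)

theory Defs
  imports "HOL-Library.Poly_Mapping" "HOL-Combinatorics.Multiset_Permutations"
begin

section \<open>Planar binary trees\<close>

text \<open>
  \<open>Leaf\<close> is $1_0$ and \<open>Graft s t\<close> is $s \vee t$. The datatype package's \<open>size\<close> counts exactly the
  internal nodes.
\<close>

datatype btree = Leaf | Graft btree btree

definition Y :: "nat \<Rightarrow> btree set"
  where "Y n = {t. size t = n}"

primrec under :: "btree \<Rightarrow> btree \<Rightarrow> btree"  \<comment> \<open>$s \backslash t$\<close>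
  where
    "under Leaf t = t"
  | "under (Graft l r) t = Graft l (under r t)"

primrec over :: "btree \<Rightarrow> btree \<Rightarrow> btree"  \<comment> \<open>$s / t$\<close>
  where
    "over s Leaf = s"
  | "over s (Graft l r) = Graft (over s l) r"

lemma size_under [simp]: "size (under s t) = size s + size t"
  by (induction s) auto

lemma size_over [simp]: "size (over s t) = size s + size t"
  by (induction t) auto

lemma finite_Y: "finite (Y n)"
proof (induction n rule: less_induct)
  case (less n)
  have "Y n \<subseteq> insert Leaf ((\<lambda>(l, r). Graft l r) ` ((\<Union>k<n. Y k) \<times> (\<Union>k<n. Y k)))"
  proof
    fix t assume "t \<in> Y n"
    then show "t \<in> insert Leaf ((\<lambda>(l, r). Graft l r) ` ((\<Union>k<n. Y k) \<times> (\<Union>k<n. Y k)))"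
      by (cases t) (auto simp: Y_def image_iff)
  qed
  then show ?case
    by (rule finite_subset) (use less in auto)
qed


section \<open>The Tamari order\<close>

inductive tamari_step :: "btree \<Rightarrow> btree \<Rightarrow> bool"
  where
    rotate: "tamari_step (Graft (Graft a b) c) (Graft a (Graft b c))"
  | left: "tamari_step l l' \<Longrightarrow> tamari_step (Graft l r) (Graft l' r)"
  | right: "tamari_step r r' \<Longrightarrow> tamari_step (Graft l r) (Graft l r')"

text \<open>The weight strictly increases along rotations; it gives antisymmetry.\<close>

primrec weight :: "btree \<Rightarrow> nat"
  where
    "weight Leaf = 0"
  | "weight (Graft l r) = weight l + weight r + size r"

lemma tamari_step_size: "tamari_step s t \<Longrightarrow> size s = size t"
  by (induction rule: tamari_step.induct) auto

lemma tamari_step_weight: "tamari_step s t \<Longrightarrow> weight s < weight t"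
  by (induction rule: tamari_step.induct) (auto dest: tamari_step_size)

lemma tamari_steps_size: "tamari_step\<^sup>*\<^sup>* s t \<Longrightarrow> size s = size t"
  by (induction rule: rtranclp_induct) (auto dest: tamari_step_size)

lemma tamari_steps_weight: "tamari_step\<^sup>*\<^sup>* s t \<Longrightarrow> s = t \<or> weight s < weight t"
  by (induction rule: rtranclp_induct) (auto dest: tamari_step_weight)

text \<open>
  One order on all trees; trees of different size are incomparable, so its restriction to \<open>Y n\<close> is
  the Tamari order on $Y_n$.
\<close>

instantiation btree :: order
begin

definition less_eq_btree :: "btree \<Rightarrow> btree \<Rightarrow> bool"
  where "s \<le> t \<longleftrightarrow> tamari_step\<^sup>*\<^sup>* s t"

definition less_btree :: "btree \<Rightarrow> btree \<Rightarrow> bool"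
  where "s < t \<longleftrightarrow> s \<le> t \<and> s \<noteq> (t :: btree)"

instance
proof
  fix x y z :: btree
  show antisym: "x \<le> y \<Longrightarrow> y \<le> x \<Longrightarrow> x = y"
    unfolding less_eq_btree_def by (force dest: tamari_steps_weight)
  show refl: "x \<le> x"
    by (simp add: less_eq_btree_def)
  show "x < y \<longleftrightarrow> x \<le> y \<and> \<not> y \<le> x"
    unfolding less_btree_def using antisym refl by blast
  show "x \<le> y \<Longrightarrow> y \<le> z \<Longrightarrow> x \<le> z"
    by (simp add: less_eq_btree_def)
qed

end

lemma tamari_size: "s \<le> t \<Longrightarrow> size s = size t" for s t :: btree
  by (simp add: less_eq_btree_def tamari_steps_size)

lemma tamari_weight: "s < t \<Longrightarrow> weight s < weight t" for s t :: btree
  using tamari_steps_weight by (auto simp: less_btree_def less_eq_btree_def)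

lemma finite_tamari_above: "finite {t. s \<le> t}" for s :: btree
  by (rule finite_subset[OF _ finite_Y[of "size s"]]) (auto simp: Y_def dest: tamari_size)

function mobius :: "btree \<Rightarrow> btree \<Rightarrow> int"
  where
    "mobius s t =
       (if s = t then 1
        else if s \<le> t then - (\<Sum>u \<in> {u. s \<le> u \<and> u < t}. mobius s u)
        else 0)"
  by auto
termination
  by (relation "measure (\<lambda>(s, t). weight t)") (auto dest: tamari_weight)

declare mobius.simps [simp del]


section \<open>The operad on trees and the bases \<open>F\<close> and \<open>M\<close>\<close>

text \<open>
  The equations with \<open>Leaf\<close> are junk values: the composition is only meant for nonempty \<open>s\<close> and \<open>t\<close>
  and $1 \le i \le |s|$.
\<close>

fun tree_comp :: "nat \<Rightarrow> btree \<Rightarrow> btree \<Rightarrow> btree"  \<comment> \<open>$B_i(s,t)$\<close>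
  where
    "tree_comp i (Graft sl sr) (Graft u v) =
       (let j = size sl + 1 in
        if j < i then Graft sl (tree_comp (i - j) sr (Graft u v))
        else if j = i then Graft (over sl u) (under v sr)
        else Graft (tree_comp i sl (Graft u v)) sr)"
  | "tree_comp i Leaf t = Leaf"
  | "tree_comp i (Graft sl sr) Leaf = Leaf"

lemma tree_comp_in_Y:
  assumes "s \<in> Y n" "t \<in> Y m" "1 \<le> i" "i \<le> n" "1 \<le> m"
  shows "tree_comp i s t \<in> Y (n + m - 1)"
proof -
  have "1 \<le> i \<Longrightarrow> i \<le> size s \<Longrightarrow> 1 \<le> size t \<Longrightarrow> size (tree_comp i s t) + 1 = size s + size t"
    by (induction i s t rule: tree_comp.induct) (auto simp: Let_def)
  then show ?thesis
    using assms by (auto simp: Y_def)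
qed

text \<open>
  \<open>btree \<Rightarrow>\<^sub>0 'k\<close> is the free module on all trees, the direct sum of the modules $\Bbbk Y_n$;
  the partial composition is the bilinear extension of \<open>tree_comp\<close>.
\<close>

definition F :: "btree \<Rightarrow> btree \<Rightarrow>\<^sub>0 'k::comm_ring_1"
  where "F t = Poly_Mapping.single t 1"

definition circ :: "nat \<Rightarrow> (btree \<Rightarrow>\<^sub>0 'k) \<Rightarrow> (btree \<Rightarrow>\<^sub>0 'k) \<Rightarrow> (btree \<Rightarrow>\<^sub>0 'k::comm_ring_1)"
  where "circ i f g =
    (\<Sum>s \<in> Poly_Mapping.keys f. \<Sum>t \<in> Poly_Mapping.keys g.
       Poly_Mapping.single (tree_comp i s t) (Poly_Mapping.lookup f s * Poly_Mapping.lookup g t))"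

definition scale :: "'k \<Rightarrow> (btree \<Rightarrow>\<^sub>0 'k) \<Rightarrow> (btree \<Rightarrow>\<^sub>0 'k::comm_ring_1)"
  where "scale c = Poly_Mapping.map ((*) c)"

definition M :: "btree \<Rightarrow> btree \<Rightarrow>\<^sub>0 'k::comm_ring_1"
  where "M s = (\<Sum>t \<in> {t. s \<le> t}. scale (of_int (mobius s t)) (F t))"

lemma lookup_scale: "Poly_Mapping.lookup (scale c f) t = c * Poly_Mapping.lookup f t"
  by (simp add: scale_def map.rep_eq when_def)

lemma circ_superset:
  assumes "finite A" "finite B" "Poly_Mapping.keys f \<subseteq> A" "Poly_Mapping.keys g \<subseteq> B"
  shows "circ i f g = (\<Sum>s \<in> A. \<Sum>t \<in> B.
    Poly_Mapping.single (tree_comp i s t) (Poly_Mapping.lookup f s * Poly_Mapping.lookup g t))"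
proof -
  have "circ i f g = (\<Sum>s \<in> Poly_Mapping.keys f. \<Sum>t \<in> B.
      Poly_Mapping.single (tree_comp i s t) (Poly_Mapping.lookup f s * Poly_Mapping.lookup g t))"
    unfolding circ_def
    by (intro sum.cong refl sum.mono_neutral_left) (use assms in \<open>auto simp: in_keys_iff\<close>)
  also have "\<dots> = (\<Sum>s \<in> A. \<Sum>t \<in> B.
      Poly_Mapping.single (tree_comp i s t) (Poly_Mapping.lookup f s * Poly_Mapping.lookup g t))"
    by (intro sum.mono_neutral_left) (use assms in \<open>auto simp: in_keys_iff\<close>)
  finally show ?thesis .
qed

lemma circ_F: "circ i (F s) (F t) = (F (tree_comp i s t) :: btree \<Rightarrow>\<^sub>0 'k::comm_ring_1)"
  by (simp add: circ_def F_def)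

lemma circ_add_left: "circ i (f + f') g = circ i f g + circ i f' g"
proof -
  let ?A = "Poly_Mapping.keys f \<union> Poly_Mapping.keys f'"
  have *: "finite ?A" "finite (Poly_Mapping.keys g)" by auto
  have "Poly_Mapping.keys (f + f') \<subseteq> ?A" by (rule keys_add)
  then show ?thesis
    by (subst (1 2 3) circ_superset[OF *])
      (auto simp: lookup_add distrib_right single_add sum.distrib)
qed

lemma circ_add_right: "circ i f (g + g') = circ i f g + circ i f g'"
proof -
  let ?B = "Poly_Mapping.keys g \<union> Poly_Mapping.keys g'"
  have *: "finite (Poly_Mapping.keys f)" "finite ?B" by auto
  have "Poly_Mapping.keys (g + g') \<subseteq> ?B" by (rule keys_add)
  then show ?thesis
    by (subst (1 2 3) circ_superset[OF *])
      (auto simp: lookup_add distrib_left single_add sum.distrib)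
qed

lemma scale_single: "scale c (Poly_Mapping.single t x) = Poly_Mapping.single t (c * x)"
  by (rule poly_mapping_eqI) (simp add: lookup_scale lookup_single when_def)

lemma scale_add: "scale c (f + g) = scale c f + scale c g"
  by (rule poly_mapping_eqI) (simp add: lookup_scale lookup_add distrib_left)

lemma scale_zero: "scale c 0 = 0"
  by (rule poly_mapping_eqI) (simp add: lookup_scale)

lemma scale_sum: "scale c (sum h A) = (\<Sum>x \<in> A. scale c (h x))"
  by (induction A rule: infinite_finite_induct) (auto simp: scale_add scale_zero)

lemma keys_scale: "Poly_Mapping.keys (scale c f) \<subseteq> Poly_Mapping.keys f"
  by (auto simp: in_keys_iff lookup_scale)

lemma circ_scale_left: "circ i (scale c f) g = scale c (circ i f g)"
  by (subst circ_superset[OF _ _ keys_scale subset_refl])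
    (simp_all add: circ_def scale_sum scale_single lookup_scale mult.assoc)

lemma circ_scale_right: "circ i f (scale c g) = scale c (circ i f g)"
  by (subst circ_superset[OF _ _ subset_refl keys_scale])
    (simp_all add: circ_def scale_sum scale_single lookup_scale mult.left_commute)


section \<open>Permutations\<close>

text \<open>
  Elements of $S_n$ are lists in \<open>permutations_of_set {1..int n}\<close>. The entry $\sigma_p$ of the list
  \<open>\<sigma>\<close> is \<open>\<sigma> ! (p - 1)\<close>.
\<close>

definition Inv :: "int list \<Rightarrow> (nat \<times> nat) set"
  where "Inv \<sigma> = {(p, q). 1 \<le> p \<and> p < q \<and> q \<le> length \<sigma> \<and> \<sigma> ! (p - 1) > \<sigma> ! (q - 1)}"

definition weak_le :: "int list \<Rightarrow> int list \<Rightarrow> bool"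
  where "weak_le \<sigma> \<tau> \<longleftrightarrow> length \<sigma> = length \<tau> \<and> Inv \<sigma> \<subseteq> Inv \<tau>"

definition st :: "int list \<Rightarrow> int list"
  where "st a = (THE \<sigma>. \<sigma> \<in> permutations_of_set {1..int (length a)} \<and>
    (\<forall>p < length a. \<forall>q < length a. \<sigma> ! p < \<sigma> ! q \<longleftrightarrow> a ! p < a ! q))"

primrec gam :: "btree \<Rightarrow> int list"  \<comment> \<open>$\gamma$\<close>
  where
    "gam Leaf = []"
  | "gam (Graft l r) =
       map (\<lambda>x. x + int (size r)) (gam l) @ [int (size (Graft l r))] @ gam r"

definition varrho :: "int list \<Rightarrow> btree"
  where "varrho \<tau> = (THE t. t \<in> Y (length \<tau>) \<and>
    (\<forall>r \<in> Y (length \<tau>). weak_le (gam r) \<tau> \<longleftrightarrow> r \<le> t))"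

definition perm_comp :: "nat \<Rightarrow> int list \<Rightarrow> int list \<Rightarrow> int list"  \<comment> \<open>$B_i(\sigma,\tau)$\<close>
  where "perm_comp i \<sigma> \<tau> =
    (let c = \<sigma> ! (i - 1);
         a = (\<lambda>x. if x < c then x else x + int (length \<tau>) - 1);
         b = (\<lambda>x. x + c - 1)
     in map a (take (i - 1) \<sigma>) @ map b \<tau> @ map a (drop i \<sigma>))"

definition seq1 :: "nat \<Rightarrow> int list \<Rightarrow> int list"  \<comment> \<open>$\mathcal{L}_1(\rho)$\<close>
  where "seq1 i \<rho> = take (i - 1) \<rho>"

definition seq2 :: "nat \<Rightarrow> nat \<Rightarrow> int list \<Rightarrow> int list"  \<comment> \<open>$\mathcal{L}_2(\rho)$\<close>
  where "seq2 i m \<rho> = take m (drop (i - 1) \<rho>)"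

definition seq3 :: "nat \<Rightarrow> nat \<Rightarrow> int list \<Rightarrow> int list"  \<comment> \<open>$\mathcal{L}_3(\rho)$\<close>
  where "seq3 i m \<rho> = drop (i - 1 + m) \<rho>"

definition perm_T :: "nat \<Rightarrow> int list \<Rightarrow> int list \<Rightarrow> int list"  \<comment> \<open>$T_i(\sigma,\tau)$\<close>
  where "perm_T i \<sigma> \<tau> =
    (let n = length \<sigma>; m = length \<tau> in
     if m = 1 then \<sigma>
     else
      (let L1 = seq1 i (perm_comp i \<sigma> \<tau>);
           L2 = seq2 i m (perm_comp i \<sigma> \<tau>);
           L3 = seq3 i m (perm_comp i \<sigma> \<tau>);
           c = \<sigma> ! (i - 1);
           \<eta> = c + int m - 1;
           k = Max {j \<in> {0..int i - 1}. {c - j..c} \<subseteq> set L1 \<union> {c}};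
           l = Max {j \<in> {0..int n - int i}. {\<eta>..\<eta> + j} \<subseteq> {\<eta>} \<union> set L3};
           A1b = {x \<in> set L1. x < c - k};
           A1t = {x \<in> set L1. x > c};
           A3b = {x \<in> set L3. x < \<eta>};
           A3t = {x \<in> set L3. x > \<eta> + l}
       in THE \<rho>. \<rho> \<in> permutations_of_set {1..int (n + m - 1)} \<and>
            st (seq1 i \<rho>) = st L1 \<and>
            st (seq2 i m \<rho>) = st L2 \<and>
            st (seq3 i m \<rho>) = st L3 \<and>
            set (seq1 i \<rho>) = A1b \<union> {\<eta> + l - k..\<eta> + l - 1} \<union> A1t \<and>
            set (seq2 i m \<rho>) = {c - k} \<union> {c - k + l + 1..\<eta> + l - k - 1} \<union> {\<eta> + l} \<and>
            set (seq3 i m \<rho>) = A3b \<union> {c - k + 1..c - k + l} \<union> A3t))"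

definition tree_T :: "nat \<Rightarrow> btree \<Rightarrow> btree \<Rightarrow> btree"  \<comment> \<open>$T_i(s,t)$\<close>
  where "tree_T i s t = varrho (perm_T i (gam s) (gam t))"

end

theory Submission
  imports Defs
begin

text \<open>
  The proof replaces trees by relations. Number the internal nodes of a tree \<open>t\<close> from left to right and
  let \<open>left_desc t p q\<close> say that node \<open>p\<close> lies in the left subtree of node \<open>q\<close>. The relations obtained in
  this way are exactly those that are transitive and contain, with a pair \<open>(p, r)\<close>, all pairs
  \<open>(q, r)\<close> with \<open>p < q < r\<close> (\<open>tree_rel_realized\<close>); the Tamari order is reverse inclusion
  (\<open>tamari_iff\<close>), and \<open>left_desc t\<close> consists of the noninversions of \<open>gam t\<close> (\<open>noninv_gam\<close>). As
  such relations are closed under intersection, $\varrho(\tau)$ is the tree of the smallest one that contains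
  the noninversions of $\tau$, and $r \le \varrho(\tau)$ means that every noninversion of $\tau$
  belongs to \<open>left_desc r\<close> (\<open>le_varrho_iff\<close>).

  In $B_i(s,t)$ a block of $|t|$ nodes takes the place of node $i$ of $s$. For a tree $r$ of the right size
  let its inner factor be the tree of \<open>left_desc r\<close> restricted to the block, and its outer
  factor the tree of the transitive closure of its image when the block is contracted to the node $i$. Then
  $B_i(s',t') \le r$ holds iff $s'$ and $t'$ are below the outer and the inner factor of $r$
  (\<open>tree_comp_le_iff\<close>). Thus the $F$ basis element of $B_i(s',t')$ is the sum of the $M_r$ over all $r$ whose
  factors are above $s'$ and $t'$, and summation against the Moebius function, which turns $F$ into $M$ on
  the left-hand side, retains those $r$ whose factors are exactly $s$ and $t$.

  It remains to see that these $r$ form the interval from $B_i(s,t)$ to $T_i(s,t)$ (\<open>tree_interval_iff\<close>).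
  Above $B_i(s,t)$, having the factors $s$ and $t$ amounts to containing a definite list \<open>top_rel\<close> of
  relations (\<open>top_rel_le_iff\<close>). The permutation $T_i(\gamma(s),\gamma(t))$ is made so that its noninversions are
  just these relations if $|t| \ge 2$ (\<open>noninv_perm_T\<close>), which is read off from an explicit form of it
  (\<open>perm_T_gam\<close>).
\<close>

section \<open>Trees as relations\<close>

text \<open>
  With the internal nodes numbered from left to right starting at 1, this says that node \<open>p\<close> lies in
  the left subtree of node \<open>q\<close>.
\<close>

primrec left_desc :: "btree \<Rightarrow> nat \<Rightarrow> nat \<Rightarrow> bool" where
  "left_desc Leaf p q \<longleftrightarrow> False"
| "left_desc (Graft l r) p q \<longleftrightarrow> left_desc l p q \<or> (1 \<le> p \<and> p \<le> size l \<and> q = size l + 1)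
     \<or> (size l + 1 < p \<and> left_desc r (p - (size l + 1)) (q - (size l + 1)))"

text \<open>
  The left descendants of a node form an interval ending just before it, and these intervals are
  nested; the last two clauses are what remains of this picture. Both are Horn clauses, so that
  relations of this kind can be intersected.
\<close>

definition tree_rel :: "nat \<Rightarrow> (nat \<Rightarrow> nat \<Rightarrow> bool) \<Rightarrow> bool" where
  "tree_rel n R \<longleftrightarrow> (\<forall>p q. R p q \<longrightarrow> 1 \<le> p \<and> p < q \<and> q \<le> n)
     \<and> (\<forall>p q r. R p q \<longrightarrow> R q r \<longrightarrow> R p r)
     \<and> (\<forall>p q r. R p r \<longrightarrow> p < q \<longrightarrow> q < r \<longrightarrow> R q r)"

lemma tree_rel_range: "tree_rel n R \<Longrightarrow> R p q \<Longrightarrow> 1 \<le> p \<and> p < q \<and> q \<le> n"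
  unfolding tree_rel_def by (elim conjE) metis

lemma tree_rel_trans: "tree_rel n R \<Longrightarrow> R p q \<Longrightarrow> R q r \<Longrightarrow> R p r"
  unfolding tree_rel_def by (elim conjE) metis

lemma tree_rel_interval: "tree_rel n R \<Longrightarrow> R p r \<Longrightarrow> p < q \<Longrightarrow> q < r \<Longrightarrow> R q r"
  unfolding tree_rel_def by (elim conjE) metis

lemma left_desc_range: "left_desc t p q \<Longrightarrow> 1 \<le> p \<and> p < q \<and> q \<le> size t"
proof (induction t arbitrary: p q)
  case (Graft l r)
  then show ?case by (auto; fastforce)
qed auto

lemma left_desc_trans: "left_desc t p q \<Longrightarrow> left_desc t q r \<Longrightarrow> left_desc t p r"
proof (induction t arbitrary: p q r)
  case (Graft t1 t2)
  then show ?case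
    by simp (elim disjE conjE; auto dest: left_desc_range)
qed simp

lemma left_desc_interval: "left_desc t p r \<Longrightarrow> p < q \<Longrightarrow> q < r \<Longrightarrow> left_desc t q r"
proof (induction t arbitrary: p q r)
  case (Graft t1 t2)
  have "left_desc t2 (q - (size t1 + 1)) (r - (size t1 + 1))" 
    if "size t1 + 1 < p" "left_desc t2 (p - (size t1 + 1)) (r - (size t1 + 1))"
    using Graft.IH(2)[OF that(2)] that Graft.prems by (simp add: diff_less_mono)
  with Graft show ?case by auto
qed simp

lemma tree_rel_left_desc: "tree_rel (size t) (left_desc t)"
  unfolding tree_rel_def
  using left_desc_range left_desc_trans left_desc_interval by blast

lemma tamari_step_left_desc: "tamari_step s t \<Longrightarrow> left_desc t p q \<Longrightarrow> left_desc s p q"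
proof (induction arbitrary: p q rule: tamari_step.induct)
  case (rotate a b c)
  then show ?case
    by (auto dest: left_desc_range simp: algebra_simps)
qed (auto dest: tamari_step_size)

lemma tamari_left_desc: "s \<le> t \<Longrightarrow> left_desc t p q \<Longrightarrow> left_desc s p q"
  unfolding less_eq_btree_def
  by (induction arbitrary: p q rule: rtranclp_induct) (auto dest: tamari_step_left_desc)

lemma tamari_Graft:
  assumes "l \<le> l'" "r \<le> r'"
  shows "Graft l r \<le> Graft l' r'"
proof -
  have "tamari_step\<^sup>*\<^sup>* (Graft l r) (Graft l' r)"
    using assms(1) unfolding less_eq_btree_def
    by (induction rule: rtranclp_induct) (auto intro: rtranclp.rtrancl_into_rtrancl tamari_step.left)
  also have "tamari_step\<^sup>*\<^sup>* (Graft l' r) (Graft l' r')"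
    using assms(2) unfolding less_eq_btree_def
    by (induction rule: rtranclp_induct) (auto intro: rtranclp.rtrancl_into_rtrancl tamari_step.right)
  finally show ?thesis by (simp add: less_eq_btree_def)
qed

text \<open>
  A node whose left subtree reaches back to the first node lies on the leftmost branch, so rotations
  along that branch bring it to the root. The pairs that these rotations destroy all straddle the node.
\<close>

lemma rotate_to_root:
  assumes "1 \<le> j" "j \<le> size s" "\<And>p. 1 \<le> p \<Longrightarrow> p < j \<Longrightarrow> left_desc s p j"
  shows "\<exists>a b. s \<le> Graft a b \<and> size a + 1 = j \<and>
    (\<forall>p q. left_desc s p q \<longrightarrow> \<not> (p \<le> j \<and> j < q) \<longrightarrow> left_desc (Graft a b) p q)"
  using assms
proof (induction s)
  case (Graft l r)
  consider "j = size l + 1" | "j \<le> size l" | "j > size l + 1" by linarith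
  then show ?case
  proof cases
    case 1
    then show ?thesis by (intro exI[of _ l] exI[of _ r]) auto
  next
    case 2
    have l: "left_desc l p j" if "1 \<le> p" "p < j" for p
      using Graft.prems(3)[OF that] 2 that by auto
    have "\<exists>a b. l \<le> Graft a b \<and> size a + 1 = j \<and>
      (\<forall>p q. left_desc l p q \<longrightarrow> \<not> (p \<le> j \<and> j < q) \<longrightarrow> left_desc (Graft a b) p q)"
      by (rule Graft.IH(1)[OF Graft.prems(1) 2]) (rule l)
    then obtain a b where ab:
      "l \<le> Graft a b" "size a + 1 = j"
      "\<And>p q. left_desc l p q \<Longrightarrow> \<not> (p \<le> j \<and> j < q) \<Longrightarrow> left_desc (Graft a b) p q"
      by (elim exE conjE) presburger
    have sz: "size l = size a + size b + 1" using tamari_size[OF ab(1)] by simp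
    have "Graft l r \<le> Graft (Graft a b) r" by (rule tamari_Graft[OF ab(1)]) simp
    also have "\<dots> \<le> Graft a (Graft b r)" unfolding less_eq_btree_def by (auto intro: tamari_step.rotate)
    finally have "Graft l r \<le> Graft a (Graft b r)" .
    moreover have "left_desc (Graft a (Graft b r)) p q"
      if "left_desc (Graft l r) p q" "\<not> (p \<le> j \<and> j < q)" for p q
    proof -
      from that(1) consider "left_desc l p q" | "1 \<le> p" "p \<le> size l" "q = size l + 1"
        | "size l + 1 < p" "left_desc r (p - (size l + 1)) (q - (size l + 1))" by auto
      then show ?thesis
      proof cases
        case 1
        from ab(3)[OF this that(2)] show ?thesis using sz left_desc_range by fastforce
      next
        case 2
        then show ?thesis using that(2) sz ab(2) by auto
      next
        case 3
        then show ?thesis using sz ab(2) by (auto simp: algebra_simps)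
      qed
    qed
    ultimately show ?thesis using ab(2) by blast
  next
    case 3
    have "left_desc (Graft l r) (size l + 1) j" using Graft.prems(3)[of "size l + 1"] 3 by simp
    then show ?thesis using 3 left_desc_range[of l "size l + 1" j] by auto
  qed
qed simp

text \<open>
  The root of \<open>t\<close> has all earlier nodes as left descendants in \<open>t\<close>, hence also in \<open>s\<close>. Rotating it to
  the root of \<open>s\<close> loses nothing that \<open>t\<close> requires, and the two halves are compared by induction.
\<close>

lemma left_desc_imp_tamari:
  assumes "size s = size t" "\<And>p q. left_desc t p q \<Longrightarrow> left_desc s p q"
  shows "s \<le> t"
  using assms
proof (induction t arbitrary: s)
  case Leaf
  then have "s = Leaf" by (cases s) auto
  then show ?case by simp
next
  case (Graft tl tr)
  let ?j = "size tl + 1"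
  have "left_desc s p ?j" if "1 \<le> p" "p < ?j" for p
    by (rule Graft.prems(2)) (use that in auto)
  then obtain a b where ab: "s \<le> Graft a b" "size a + 1 = ?j"
    "\<And>p q. left_desc s p q \<Longrightarrow> \<not> (p \<le> ?j \<and> ?j < q) \<Longrightarrow> left_desc (Graft a b) p q"
    using rotate_to_root[of ?j s] Graft.prems(1) by auto
  have szb: "size b = size tr" using tamari_size[OF ab(1)] Graft.prems(1) ab(2) by auto
  have T: "left_desc (Graft a b) p q" if "left_desc (Graft tl tr) p q" for p q
  proof (rule ab(3)[OF Graft.prems(2)[OF that]])
    show "\<not> (p \<le> ?j \<and> ?j < q)"
      using that left_desc_range[of tl p q] by auto
  qed
  have "a \<le> tl"
  proof (rule Graft.IH(1))
    fix p q assume "left_desc tl p q"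
    then show "left_desc a p q"
      using T[of p q] left_desc_range[of tl p q] ab(2) by auto
  qed (use ab(2) in auto)
  moreover have "b \<le> tr"
  proof (rule Graft.IH(2)[OF szb])
    fix p q assume "left_desc tr p q"
    then show "left_desc b p q"
      using T[of "p + ?j" "q + ?j"] left_desc_range[of tr p q] left_desc_range[of a "p + ?j" "q + ?j"] ab(2) by auto
  qed
  ultimately show ?case using ab(1) tamari_Graft order_trans by blast
qed

theorem tamari_iff: "s \<le> t \<longleftrightarrow> size s = size t \<and> (\<forall>p q. left_desc t p q \<longrightarrow> left_desc s p q)"
  using left_desc_imp_tamari tamari_left_desc tamari_size by blast

lemma left_desc_inj: "size s = size t \<Longrightarrow> left_desc s = left_desc t \<Longrightarrow> s = t"
  by (rule antisym) (auto intro: left_desc_imp_tamari)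

text \<open>
  The root must be the last position that has all earlier positions below it. No pair straddles such a
  position, since its upper end would otherwise be a later position of the same kind; the relation
  therefore splits into the relations of the two subtrees.
\<close>

lemma tree_rel_realized:
  assumes "tree_rel n R"
  shows "\<exists>t. size t = n \<and> left_desc t = R"
  using assms
proof (induction n arbitrary: R rule: less_induct)
  case (less n)
  note rng = tree_rel_range[OF less.prems] and tr = tree_rel_trans[OF less.prems]
    and iv = tree_rel_interval[OF less.prems]
  show ?case
  proof (cases "n = 0")
    case True
    then show ?thesis using rng by (intro exI[of _ Leaf]) (auto simp: fun_eq_iff)
  next
    case False
    \<comment> \<open>Candidates for the root: the positions that have all earlier positions below them.\<close>
    define S where "S = {q \<in> {1..n}. \<forall>p. 1 \<le> p \<longrightarrow> p < q \<longrightarrow> R p q}"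
    define j where "j = Max S"
    have "finite S" "1 \<in> S" using False by (auto simp: S_def)
    then have jS: "j \<in> S" and jmax: "\<And>q. q \<in> S \<Longrightarrow> q \<le> j"
      unfolding j_def using Max_in by (blast, simp)
    have cross: "\<not> (p \<le> j \<and> j < q)" if "R p q" for p q
    proof
      assume pq: "p \<le> j \<and> j < q"
      have "R j q" using that pq iv by (cases "p = j") auto
      have "R x q" if "1 \<le> x" "x < q" for x
      proof (cases "x < j")
        case True
        then show ?thesis using jS that tr[OF _ \<open>R j q\<close>] by (auto simp: S_def)
      next
        case False
        then show ?thesis using \<open>R j q\<close> iv that by (cases "x = j") auto
      qed
      then have "q \<in> S" using rng[OF that] by (auto simp: S_def)
      then show False using jmax pq by fastforce
    qed
    have "tree_rel (j - 1) (\<lambda>p q. R p q \<and> q < j)"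
      unfolding tree_rel_def
    proof (intro conjI allI impI)
      fix p q assume "R p q \<and> q < j"
      then show "1 \<le> p" "p < q" "q \<le> j - 1" using rng[of p q] by auto
    next
      fix p q r assume *: "R p q \<and> q < j"
      show "R p r" "r < j" if "R q r \<and> r < j" using * that tr by blast+
    next
      fix p q r assume *: "R p r \<and> r < j" "p < q" "q < r"
      show "R q r" "r < j" using * iv by blast+
    qed
    moreover have "j - 1 < n" using jS by (auto simp: S_def)
    ultimately obtain a where a: "size a = j - 1" "left_desc a = (\<lambda>p q. R p q \<and> q < j)"
      using less.IH by blast
    have "tree_rel (n - j) (\<lambda>p q. 1 \<le> p \<and> R (p + j) (q + j))"
      unfolding tree_rel_def
    proof (intro conjI allI impI)
      fix p q assume "1 \<le> p \<and> R (p + j) (q + j)"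
      then show "1 \<le> p" "p < q" "q \<le> n - j" using rng[of "p + j" "q + j"] by auto
    next
      fix p q r assume *: "1 \<le> p \<and> R (p + j) (q + j)"
      show "1 \<le> p" using * by blast
      show "R (p + j) (r + j)" if "1 \<le> q \<and> R (q + j) (r + j)" using * tr that by blast
    next
      fix p q r assume *: "1 \<le> p \<and> R (p + j) (r + j)" "p < q" "q < r"
      then show "1 \<le> q" by linarith
      show "R (q + j) (r + j)" using * iv[of "p + j" "r + j" "q + j"] by simp
    qed
    moreover have "n - j < n" using jS by (auto simp: S_def)
    ultimately obtain b where b: "size b = n - j" "left_desc b = (\<lambda>p q. 1 \<le> p \<and> R (p + j) (q + j))"
      using less.IH by blast
    have j1: "1 \<le> j" "j \<le> n" using jS by (auto simp: S_def)
    have "left_desc (Graft a b) p q = R p q" for p q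
    proof -
      have "left_desc (Graft a b) p q \<longleftrightarrow> (R p q \<and> q < j) \<or> (1 \<le> p \<and> p < j \<and> q = j) \<or>
          (j < p \<and> 1 \<le> p - j \<and> R (p - j + j) (q - j + j))"
        using a b j1 by auto
      also have "\<dots> \<longleftrightarrow> R p q"
      proof (cases "R p q")
        case True
        then show ?thesis using cross[OF True] rng[OF True] by auto
      next
        case False
        have "\<not> (1 \<le> p \<and> p < j \<and> q = j)" using False jS by (auto simp: S_def)
        moreover have "\<not> (j < p \<and> R (p - j + j) (q - j + j))"
          using False rng[of p "q - j + j"] by (cases "j \<le> q") auto
        ultimately show ?thesis using False by blast
      qed
      finally show ?thesis .
    qed
    then show ?thesis using a b j1 by (intro exI[of _ "Graft a b"]) (auto simp: fun_eq_iff)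
  qed
qed

section \<open>Noninversions and the adjoint of the embedding into permutations\<close>

lemma length_gam [simp]: "length (gam t) = size t"
  by (induction t) auto

lemma set_gam: "set (gam t) = {1..int (size t)}"
proof (induction t)
  case (Graft l r)
  have "(\<lambda>x. x + int (size r)) ` {1..int (size l)} = {1 + int (size r)..int (size l) + int (size r)}"
    by (simp add: image_add_atLeastAtMost' add.commute)
  with Graft show ?case by auto
qed auto

lemma distinct_gam: "distinct (gam t)"
  by (rule card_distinct) (simp add: set_gam)

lemma gam_nth_range:
  assumes "1 \<le> p" "p \<le> size t"
  shows "1 \<le> gam t ! (p - 1)" "gam t ! (p - 1) \<le> int (size t)"
proof -
  have "gam t ! (p - 1) \<in> set (gam t)" using assms by (intro nth_mem) auto
  then show "1 \<le> gam t ! (p - 1)" "gam t ! (p - 1) \<le> int (size t)" by (auto simp: set_gam)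
qed

lemma gam_Graft_nth:
  assumes "1 \<le> p" "p \<le> size (Graft l r)"
  shows "gam (Graft l r) ! (p - 1) =
    (if p \<le> size l then gam l ! (p - 1) + int (size r)
     else if p = size l + 1 then int (size l + size r + 1) else gam r ! (p - (size l + 1) - 1))"
  using assms by (auto simp: nth_append nth_Cons' algebra_simps)

text \<open>
  In \<open>gam (Graft l r)\<close> the entries of \<open>l\<close> exceed those of \<open>r\<close>, and the root exceeds both: an
  earlier entry is smaller exactly when the later one is an ancestor that has it on its left.
\<close>

lemma gam_less_iff:
  assumes "1 \<le> p" "p < q" "q \<le> size t"
  shows "gam t ! (p - 1) < gam t ! (q - 1) \<longleftrightarrow> left_desc t p q"
  using assms
proof (induction t arbitrary: p q)
  case (Graft l r)
  let ?j = "size l + 1"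
  have pq: "gam (Graft l r) ! (p - 1) = (if p \<le> size l then gam l ! (p - 1) + int (size r)
     else if p = size l + 1 then int (size l + size r + 1) else gam r ! (p - ?j - 1))"
    "gam (Graft l r) ! (q - 1) = (if q \<le> size l then gam l ! (q - 1) + int (size r)
     else if q = size l + 1 then int (size l + size r + 1) else gam r ! (q - ?j - 1))"
    using Graft.prems by (intro gam_Graft_nth; simp)+
  consider "q \<le> size l" | "p \<le> size l" "q = ?j" | "p \<le> size l" "q > ?j" | "p = ?j" | "p > ?j"
    by linarith
  then show ?case
  proof cases
    case 1
    then show ?thesis using Graft.prems Graft.IH(1)[of p q] unfolding pq by auto
  next
    case 2
    then show ?thesis using Graft.prems gam_nth_range[of p l] unfolding pq by auto
  next
    case 3
    then have "1 \<le> q - ?j" "q - ?j \<le> size r" using Graft.prems by auto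
    with 3 show ?thesis
      using Graft.prems gam_nth_range[of p l] gam_nth_range[of "q - ?j" r] left_desc_range[of l p q]
      unfolding pq by auto
  next
    case 4
    then have "1 \<le> q - ?j" "q - ?j \<le> size r" using Graft.prems by auto
    with 4 show ?thesis
      using Graft.prems gam_nth_range[of "q - ?j" r] left_desc_range[of l p q]
      unfolding pq by auto
  next
    case 5
    then show ?thesis
      using Graft.prems Graft.IH(2)[of "p - ?j" "q - ?j"] left_desc_range[of l p q]
      unfolding pq by auto
  qed
qed simp

text \<open>
  The weak comparison of entries makes \<open>noninv\<close> the exact complement of \<open>Inv\<close> for every list.
\<close>

definition noninv :: "int list \<Rightarrow> nat \<Rightarrow> nat \<Rightarrow> bool" where
  "noninv \<tau> p q \<longleftrightarrow> 1 \<le> p \<and> p < q \<and> q \<le> length \<tau> \<and> \<tau> ! (p - 1) \<le> \<tau> ! (q - 1)"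

lemma noninv_gam: "noninv (gam s) p q \<longleftrightarrow> left_desc s p q"
proof (cases "1 \<le> p \<and> p < q \<and> q \<le> size s")
  case True
  then have "gam s ! (p - 1) \<noteq> gam s ! (q - 1)"
    by (subst nth_eq_iff_index_eq) (auto simp: distinct_gam)
  then show ?thesis using True gam_less_iff[of p q s] by (auto simp: noninv_def)
next
  case False
  then show ?thesis using left_desc_range[of s p q] by (auto simp: noninv_def)
qed

lemma weak_le_gam_iff:
  assumes "size r = length \<tau>"
  shows "weak_le (gam r) \<tau> \<longleftrightarrow> (\<forall>p q. noninv \<tau> p q \<longrightarrow> left_desc r p q)"
proof -
  have "gam r ! (p - 1) > gam r ! (q - 1) \<longleftrightarrow> \<not> left_desc r p q"
    if "1 \<le> p" "p < q" "q \<le> length \<tau>" for p q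
  proof -
    have "gam r ! (p - 1) \<noteq> gam r ! (q - 1)"
      using that assms by (subst nth_eq_iff_index_eq) (auto simp: distinct_gam)
    then show ?thesis using gam_less_iff[of p q r] that assms by auto
  qed
  then have "weak_le (gam r) \<tau> \<longleftrightarrow>
      (\<forall>p q. 1 \<le> p \<and> p < q \<and> q \<le> length \<tau> \<and> \<not> left_desc r p q \<longrightarrow> \<tau> ! (p - 1) > \<tau> ! (q - 1))"
    unfolding weak_le_def Inv_def using assms by auto
  also have "\<dots> \<longleftrightarrow> (\<forall>p q. noninv \<tau> p q \<longrightarrow> left_desc r p q)"
    unfolding noninv_def by (metis not_less)
  finally show ?thesis .
qed

text \<open>
  The smallest tree relation containing the noninversions of \<open>\<tau>\<close> is an intersection, and the tree that
  realizes it is the right adjoint: a tree relation contains this intersection as soon as it contains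
  the noninversions themselves.
\<close>

lemma le_varrho_iff:
  assumes "size r = length \<tau>"
  shows "r \<le> varrho \<tau> \<longleftrightarrow> (\<forall>p q. noninv \<tau> p q \<longrightarrow> left_desc r p q)"
proof -
  let ?n = "length \<tau>"
  let ?adm = "\<lambda>R. tree_rel ?n R \<and> (\<forall>p q. noninv \<tau> p q \<longrightarrow> R p q)"
  define C where "C p q \<longleftrightarrow> (\<forall>R. ?adm R \<longrightarrow> R p q)" for p q
  have full: "?adm (\<lambda>p q. 1 \<le> p \<and> p < q \<and> q \<le> ?n)"
    by (auto simp: tree_rel_def noninv_def)
  have "tree_rel ?n C"
    unfolding tree_rel_def
  proof (intro conjI allI impI)
    fix p q assume "C p q"
    then have "1 \<le> p \<and> p < q \<and> q \<le> ?n" unfolding C_def using full by blast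
    then show "1 \<le> p" "p < q" "q \<le> ?n" by auto
  next
    fix p q r assume "C p q" "C q r"
    then show "C p r" unfolding C_def using tree_rel_trans by blast
  next
    fix p q r assume "C p r" "p < q" "q < r"
    then show "C q r" unfolding C_def using tree_rel_interval by blast
  qed
  then obtain t where t: "size t = ?n" "left_desc t = C" using tree_rel_realized by blast
  have adj: "weak_le (gam r) \<tau> \<longleftrightarrow> r \<le> t" if "r \<in> Y ?n" for r
  proof -
    have sz: "size r = ?n" using that by (simp add: Y_def)
    have "r \<le> t \<longleftrightarrow> (\<forall>p q. C p q \<longrightarrow> left_desc r p q)"
      using sz t by (simp add: tamari_iff)
    also have "\<dots> \<longleftrightarrow> (\<forall>p q. noninv \<tau> p q \<longrightarrow> left_desc r p q)"
      using tree_rel_left_desc[of r] sz unfolding C_def by auto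
    finally show ?thesis using weak_le_gam_iff[OF sz] by blast
  qed
  have "varrho \<tau> = t"
    unfolding varrho_def
  proof (rule the_equality)
    show "t \<in> Y ?n \<and> (\<forall>r\<in>Y ?n. weak_le (gam r) \<tau> \<longleftrightarrow> r \<le> t)"
      using adj t by (simp add: Y_def)
  next
    fix t' assume t': "t' \<in> Y ?n \<and> (\<forall>r\<in>Y ?n. weak_le (gam r) \<tau> \<longleftrightarrow> r \<le> t')"
    have tY: "t \<in> Y ?n" using t by (simp add: Y_def)
    have "t \<le> t'" using t' tY adj[OF tY] by auto
    moreover have "t' \<le> t" using t' adj[of t'] by auto
    ultimately show "t' = t" by simp
  qed
  then show ?thesis using adj[of r] weak_le_gam_iff[OF assms] assms by (simp add: Y_def)
qed

section \<open>Left descendants in a composition\<close>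

lemma left_desc_under:
  "left_desc (under s t) p q \<longleftrightarrow>
    left_desc s p q \<or> (size s < p \<and> left_desc t (p - size s) (q - size s))"
proof (induction s arbitrary: p q)
  case (Graft l r)
  have "left_desc (under r t) (p - (size l + 1)) (q - (size l + 1)) \<longleftrightarrow>
     left_desc r (p - (size l + 1)) (q - (size l + 1)) \<or>
     size r < p - (size l + 1) \<and> left_desc t (p - (size l + size r + 1)) (q - (size l + size r + 1))"
    unfolding Graft.IH(2) by (simp add: algebra_simps)
  then show ?case by (simp add: less_diff_conv algebra_simps) linarith
qed (auto dest: left_desc_range)

text \<open>
  Gluing \<open>s\<close> to the first leaf of \<open>t\<close> puts all its nodes below exactly the nodes on the leftmost branch
  of \<open>t\<close>: the first node and those that have the first node as a left descendant.
\<close>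

lemma left_desc_over:
  "left_desc (over s t) p q \<longleftrightarrow>
    left_desc s p q \<or> (size s < p \<and> left_desc t (p - size s) (q - size s)) \<or>
    (1 \<le> p \<and> p \<le> size s \<and> size s < q \<and> q \<le> size s + size t \<and>
      (q = size s + 1 \<or> left_desc t 1 (q - size s)))"
proof (induction t arbitrary: p q)
  case (Graft l r)
  have d: "p - size s - (size l + 1) = p - (size s + size l + 1)" for p by simp
  have rr: "left_desc r (1 - (size l + 1)) x \<longleftrightarrow> False" for x
    using left_desc_range[of r 0 x] by auto
  show ?case
    using left_desc_range[of s p q] left_desc_range[of l "p - size s" "q - size s"]
      left_desc_range[of l 1 "q - size s"]
    by (auto simp: Graft.IH(1) rr d)
qed (auto dest: left_desc_range)

text \<open>
  The map that contracts the block \<open>{i..<i + m}\<close>, which the nodes of \<open>t\<close> occupy in \<open>tree_comp i s t\<close>,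
  to the node \<open>i\<close> of \<open>s\<close> that they replace.
\<close>

definition fuse :: "nat \<Rightarrow> nat \<Rightarrow> nat \<Rightarrow> nat" where
  "fuse i m p = (if p < i then p else if p < i + m then i else p + 1 - m)"

lemma size_tree_comp:
  assumes "1 \<le> i" "i \<le> size s" "1 \<le> size t"
  shows "size (tree_comp i s t) = size s + size t - 1"
  using tree_comp_in_Y[of s "size s" t "size t" i] assms by (simp add: Y_def)

lemma fuse_shift: "fuse (j + i) m (j + p) = j + fuse i m p"
  by (auto simp: fuse_def)

text \<open>
  Nodes of the block keep their relations in \<open>t\<close>; all other pairs are related as in \<open>s\<close> after contracting
  the block. The side condition arises because the left subtree of node \<open>i\<close> is glued to the
  leftmost branch of \<open>t\<close>: its nodes lie below a node of the block only if that node is on this branch.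
\<close>

lemma left_desc_tree_comp:
  assumes "1 \<le> i" "i \<le> size s" "1 \<le> size t"
  shows "left_desc (tree_comp i s t) p q \<longleftrightarrow>
    (if i \<le> p \<and> p < i + size t \<and> i \<le> q \<and> q < i + size t then left_desc t (p + 1 - i) (q + 1 - i)
     else left_desc s (fuse i (size t) p) (fuse i (size t) q) \<and>
       (p < i \<and> i \<le> q \<and> q < i + size t \<longrightarrow> q = i \<or> left_desc t 1 (q + 1 - i)))"
  using assms
proof (induction i s t arbitrary: p q rule: tree_comp.induct)
  case (1 i sl sr u v)
  let ?t = "Graft u v" and ?j = "size sl + 1"
  \<comment> \<open>The node \<open>i\<close> lies in the right subtree, is the root, or lies in the left subtree.\<close>
  consider "?j < i" | "?j = i" | "?j > i" by linarith
  then show ?case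
  proof cases
    case 1
    then obtain i' where i': "i = ?j + i'" "1 \<le> i'" using less_imp_add_positive[of ?j i] by auto
    have i: "1 \<le> i'" "i' \<le> size sr" using i' "1.prems" by auto
    have IH: "left_desc (tree_comp i' sr ?t) p q \<longleftrightarrow>
      (if i' \<le> p \<and> p < i' + size ?t \<and> i' \<le> q \<and> q < i' + size ?t then left_desc ?t (p + 1 - i') (q + 1 - i')
       else left_desc sr (fuse i' (size ?t) p) (fuse i' (size ?t) q) \<and>
         (p < i' \<and> i' \<le> q \<and> q < i' + size ?t \<longrightarrow> q = i' \<or> left_desc ?t 1 (q + 1 - i')))" for p q
      using "1.IH"(1)[OF refl 1, of p q] i "1.prems"(3) i' by (simp del: left_desc.simps)
    have comp: "tree_comp i (Graft sl sr) ?t = Graft sl (tree_comp i' sr ?t)"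
      using i' by simp
    show ?thesis
    proof (cases "p \<le> ?j")
      case True
      have "fuse i (size ?t) p = p" using True 1 by (simp add: fuse_def)
      moreover have "fuse i (size ?t) q = q \<and> q < i \<or> fuse i (size ?t) q > ?j \<and> q > ?j"
        using 1 by (auto simp: fuse_def)
      ultimately show ?thesis unfolding comp using True 1
        by (auto simp del: left_desc.simps(1) dest: left_desc_range)
    next
      case False
      then obtain p' where p: "p = ?j + p'" "1 \<le> p'" using less_imp_add_positive[of ?j p] by auto
      show ?thesis
      proof (cases "q \<le> ?j")
        case True
        have "fuse i (size ?t) q = q" using True 1 by (simp add: fuse_def)
        moreover have "fuse i (size ?t) p > ?j" using 1 p by (auto simp: fuse_def)
        ultimately show ?thesis using True False 1 left_desc_range[of "tree_comp i (Graft sl sr) ?t" p q]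
            left_desc_range[of "Graft sl sr" "fuse i (size ?t) p" "fuse i (size ?t) q"]
          by (auto simp del: left_desc.simps tree_comp.simps)
      next
        case False
        then obtain q' where q: "q = ?j + q'" "1 \<le> q'" using less_imp_add_positive[of ?j q] by auto
        have e: "left_desc (Graft a b) (size a + 1 + x) (size a + 1 + y) \<longleftrightarrow> left_desc b x y"
          if "1 \<le> x" for a b x y
          using that left_desc_range[of a] by fastforce
        have f: "1 \<le> fuse i' (size ?t) p'" using i p by (auto simp: fuse_def)
        show ?thesis unfolding comp unfolding p(1) q(1) i'(1) fuse_shift e[OF p(2)] e[OF f] IH
          by (simp del: left_desc.simps)
      qed
    qed
  next
    case 2
    have comp: "tree_comp i (Graft sl sr) ?t = Graft (over sl u) (under v sr)"
      using 2 by simp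
    define a b c where abc: "a = size sl" "b = size u" "c = size v"
    have rng: "left_desc r x y \<longleftrightarrow> left_desc r x y \<and> 1 \<le> x \<and> x < y \<and> y \<le> size r" for r x y
      using left_desc_range by blast
    have L: "left_desc (Graft (over sl u) (under v sr)) p q \<longleftrightarrow>
      left_desc sl p q \<or> (a < p \<and> left_desc u (p - a) (q - a)) \<or>
      (1 \<le> p \<and> p \<le> a \<and> a < q \<and> q \<le> a + b \<and> (q = a + 1 \<or> left_desc u 1 (q - a))) \<or>
      (1 \<le> p \<and> p \<le> a + b \<and> q = a + b + 1) \<or>
      (a + b + 1 < p \<and> left_desc v (p - (a + b + 1)) (q - (a + b + 1))) \<or>
      (a + b + c + 1 < p \<and> left_desc sr (p - (a + b + c + 1)) (q - (a + b + c + 1)))" for p q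
      by (auto simp: left_desc_over left_desc_under abc algebra_simps)
    have t: "left_desc ?t x y \<longleftrightarrow> left_desc u x y \<or> (1 \<le> x \<and> x \<le> b \<and> y = b + 1) \<or>
       (b + 1 < x \<and> left_desc v (x - (b + 1)) (y - (b + 1)))" for x y
      by (simp add: abc)
    have s: "left_desc (Graft sl sr) x y \<longleftrightarrow> left_desc sl x y \<or> (1 \<le> x \<and> x \<le> a \<and> y = a + 1) \<or>
       (a + 1 < x \<and> left_desc sr (x - (a + 1)) (y - (a + 1)))" for x y
      by (simp add: abc)
    have m: "size ?t = b + c + 1" and i: "i = a + 1" using 2 by (simp_all add: abc)
    have v1: "\<not> left_desc v 0 x" for x using left_desc_range[of v 0 x] by auto
    note rs = left_desc_range[of sl p q, folded abc] left_desc_range[of u "p - a" "q - a", folded abc]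
        left_desc_range[of v "p - (a + b + 1)" "q - (a + b + 1)", folded abc] left_desc_range[of u 1 "q - a", folded abc]
        left_desc_range[of sr "p - (a + b + c + 1)" "q - (a + b + c + 1)"]
    consider "p \<le> a" | "a < p" "p \<le> a + b + c + 1" | "p > a + b + c + 1" by linarith
    then show ?thesis
    proof cases
      case 1
      then show ?thesis unfolding comp L s t m unfolding i using rs v1 left_desc_range[of sl p "a + 1"] left_desc_range[of sl p "q - (b + c)"]
        by (auto simp: fuse_def simp flip: abc)
    next
      case 2
      show ?thesis
      proof (cases "a < q \<and> q \<le> a + b + c + 1")
        case True
        then obtain p' q' where pq: "p = a + p'" "q = a + q'"
          using 2 by (metis le_add_diff_inverse less_imp_le_nat)
        have z: "left_desc sl (a + p') y \<longleftrightarrow> False" "left_desc sr (p' - (b + c + 1)) (q' - (b + c + 1)) \<longleftrightarrow> False"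
          for y using left_desc_range[of sl "a + p'" y] 2 True pq
            left_desc_range[of sr "p' - (b + c + 1)" "q' - (b + c + 1)"] by (auto simp: abc)
        show ?thesis unfolding comp L s t m unfolding i
          using 2 True z by (auto simp: pq)
      next
        case False
        have "\<not> left_desc (Graft (over sl u) (under v sr)) p q"
          unfolding L using False 2 rs by auto
        moreover have "fuse i (size ?t) q \<le> a \<or> fuse i (size ?t) q > a + 1" "fuse i (size ?t) p = a + 1"
          unfolding m unfolding i using False 2 by (auto simp: fuse_def)
        then have "\<not> left_desc (Graft sl sr) (fuse i (size ?t) p) (fuse i (size ?t) q)"
          unfolding s using left_desc_range[of sl "a + 1" "fuse i (size ?t) q"]
          by (auto simp flip: abc)
        moreover have "\<not> p < i" "\<not> (i \<le> q \<and> q < i + size ?t)" using 2 False unfolding m i by auto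
        ultimately show ?thesis unfolding comp by (auto simp del: left_desc.simps btree.size)
      qed
    next
      case 3
      then obtain p' where p: "p = a + b + c + 1 + p'" "1 \<le> p'"
        using less_imp_add_positive[of "a + b + c + 1" p] by auto
      have fp: "fuse i (size ?t) p = a + 1 + p'" unfolding m i p by (simp add: fuse_def)
      show ?thesis
      proof (cases "q > p")
        case True
        then obtain q' where q: "q = a + b + c + 1 + q'" "p' < q'"
          using p less_imp_add_positive[of "p" q] by (metis add.assoc less_add_same_cancel1)
        have fq: "fuse i (size ?t) q = a + 1 + q'" unfolding m i q by (simp add: fuse_def)
        have z: "a \<le> x \<Longrightarrow> \<not> left_desc sl x y" "b \<le> x \<Longrightarrow> \<not> left_desc u x y"
          "c \<le> x \<Longrightarrow> \<not> left_desc v x y" for x y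
          using left_desc_range[of sl x y] left_desc_range[of u x y]
            left_desc_range[of v x y] by (auto simp: abc)
        have "left_desc (Graft (over sl u) (under v sr)) p q \<longleftrightarrow> left_desc sr p' q'"
          unfolding L p(1) q(1) using z p q by (auto simp: add.assoc)
        moreover have "left_desc (Graft sl sr) (a + 1 + p') (a + 1 + q') \<longleftrightarrow> left_desc sr p' q'"
          unfolding s using z less_le_trans[OF zero_less_one p(2)] by (simp add: add.assoc)
        moreover have "\<not> p < i" "\<not> p < i + size ?t" using p(2) unfolding m i p(1) by auto
        ultimately show ?thesis unfolding comp fp fq by (auto simp del: left_desc.simps btree.size)
      next
        case False
        then have "fuse i (size ?t) q \<le> fuse i (size ?t) p" by (auto simp: fuse_def)
        then have "\<not> left_desc (Graft sl sr) (fuse i (size ?t) p) (fuse i (size ?t) q)"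
          using left_desc_range[of "Graft sl sr" "fuse i (size ?t) p" "fuse i (size ?t) q"] by linarith
        moreover have "\<not> left_desc (tree_comp i (Graft sl sr) ?t) p q"
          using left_desc_range[of "tree_comp i (Graft sl sr) ?t" p q] False by linarith
        moreover have "\<not> p < i + size ?t" using p(2) unfolding m i p(1) by simp
        ultimately show ?thesis by (auto simp del: left_desc.simps tree_comp.simps btree.size)
      qed
    qed
  next
    case 3
    have i: "i \<le> size sl" using 3 by auto
    have comp: "tree_comp i (Graft sl sr) ?t = Graft (tree_comp i sl ?t) sr"
      using 3 by simp
    have sz: "size (tree_comp i sl ?t) + 1 = size sl + size ?t"
      using size_tree_comp[OF "1.prems"(1) i "1.prems"(3)] by simp
    have IH: "left_desc (tree_comp i sl ?t) p q \<longleftrightarrow>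
      (if i \<le> p \<and> p < i + size ?t \<and> i \<le> q \<and> q < i + size ?t then left_desc ?t (p + 1 - i) (q + 1 - i)
       else left_desc sl (fuse i (size ?t) p) (fuse i (size ?t) q) \<and>
         (p < i \<and> i \<le> q \<and> q < i + size ?t \<longrightarrow> q = i \<or> left_desc ?t 1 (q + 1 - i)))" for p q
      using "1.IH"(2)[OF refl _ _ "1.prems"(1) i "1.prems"(3)] 3 by (simp del: left_desc.simps)
    define m a where ma: "m = size ?t" "a = size sl"
    have m1: "1 \<le> m" by (simp add: ma)
    have g: "left_desc (Graft (tree_comp i sl ?t) sr) p q \<longleftrightarrow> left_desc (tree_comp i sl ?t) p q \<or>
        (1 \<le> p \<and> p \<le> a + m - 1 \<and> q = a + m) \<or> (a + m < p \<and> left_desc sr (p - (a + m)) (q - (a + m)))"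
      using sz by (auto simp: ma)
    have s: "left_desc (Graft sl sr) x y \<longleftrightarrow> left_desc sl x y \<or> (1 \<le> x \<and> x \<le> a \<and> y = a + 1) \<or>
       (a + 1 < x \<and> left_desc sr (x - (a + 1)) (y - (a + 1)))" for x y
      by (simp add: ma)
    have F1: "fuse i m x = a + 1 \<longleftrightarrow> x = a + m" for x
      using i m1 by (auto simp: fuse_def ma(2))
    have F2: "fuse i m x \<le> a \<longleftrightarrow> x < a + m" for x
      using i m1 by (auto simp: fuse_def ma(2))
    have F3: "fuse i m x - (a + 1) = x - (a + m)" for x
      using i m1 by (auto simp: fuse_def ma(2))
    have F4: "1 \<le> fuse i m x \<longleftrightarrow> 1 \<le> x" for x
      using i m1 "1.prems"(1) by (auto simp: fuse_def ma(2))
    have F5: "a + 1 < fuse i m x \<longleftrightarrow> a + m < x" for x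
      using i m1 by (auto simp: fuse_def ma(2))
    have nb: "p < i + m \<Longrightarrow> q < i + m \<Longrightarrow> p < a + m \<and> q < a + m" using i ma by auto
    show ?thesis unfolding comp g IH s ma(1)[symmetric] F1 F3 F4 F2 F5
      using nb i m1 by (auto simp del: left_desc.simps simp: ma(2))
  qed
qed auto

section \<open>The factors of a tree\<close>

lemma fuse_mono: "p \<le> q \<Longrightarrow> fuse i m p \<le> fuse i m q"
  by (auto simp: fuse_def)

lemma fuse_less_imp_less: "fuse i m p < fuse i m q \<Longrightarrow> p < q"
  by (meson fuse_mono leD leI)

lemma fuse_eq_iff:
  "fuse i m p = fuse i m q \<longleftrightarrow> p = q \<or> (i \<le> p \<and> p < i + m \<and> i \<le> q \<and> q < i + m)" if "1 \<le> m"
  using that by (auto simp: fuse_def)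

lemma fuse_surj: "1 \<le> m \<Longrightarrow> \<exists>p. fuse i m p = x"
  by (rule exI[of _ "if x \<le> i then x else x + m - 1"]) (auto simp: fuse_def)

lemma fuse_less_iff: "1 \<le> m \<Longrightarrow> fuse i m p < i \<longleftrightarrow> p < i"
  and fuse_eq_block_iff: "1 \<le> m \<Longrightarrow> fuse i m p = i \<longleftrightarrow> i \<le> p \<and> p < i + m"
  by (auto simp: fuse_def)

lemma fuse_range: "1 \<le> i \<Longrightarrow> 1 \<le> m \<Longrightarrow> 1 \<le> p \<Longrightarrow> 1 \<le> fuse i m p"
  and fuse_range': "i \<le> n \<Longrightarrow> 1 \<le> m \<Longrightarrow> p \<le> n + m - 1 \<Longrightarrow> fuse i m p \<le> n"
  by (auto simp: fuse_def)

definition fuse_rel :: "nat \<Rightarrow> nat \<Rightarrow> (nat \<Rightarrow> nat \<Rightarrow> bool) \<Rightarrow> nat \<Rightarrow> nat \<Rightarrow> bool" where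
  "fuse_rel i m R x y \<longleftrightarrow> x \<noteq> y \<and> (\<exists>p q. R p q \<and> x = fuse i m p \<and> y = fuse i m q)"

text \<open>
  The image of a tree relation under contraction can fail to be transitive only at the node \<open>i\<close>, because
  a path through \<open>i\<close> may enter and leave the block at different nodes. One composition repairs this.
\<close>

definition contract_rel :: "nat \<Rightarrow> nat \<Rightarrow> (nat \<Rightarrow> nat \<Rightarrow> bool) \<Rightarrow> nat \<Rightarrow> nat \<Rightarrow> bool" where
  "contract_rel i m R x y \<longleftrightarrow> fuse_rel i m R x y \<or> (fuse_rel i m R x i \<and> fuse_rel i m R i y)"

definition block_rel :: "nat \<Rightarrow> nat \<Rightarrow> (nat \<Rightarrow> nat \<Rightarrow> bool) \<Rightarrow> nat \<Rightarrow> nat \<Rightarrow> bool" where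
  "block_rel i m R p q \<longleftrightarrow> 1 \<le> p \<and> q \<le> m \<and> R (p + i - 1) (q + i - 1)"

lemma tree_rel_block_rel:
  assumes "tree_rel N R" "1 \<le> i"
  shows "tree_rel m (block_rel i m R)"
  unfolding tree_rel_def
proof (intro conjI allI impI)
  fix p q assume "block_rel i m R p q"
  then show "1 \<le> p" "p < q" "q \<le> m"
    using tree_rel_range[OF assms(1), of "p + i - 1" "q + i - 1"] by (auto simp: block_rel_def)
next
  fix p q r assume "block_rel i m R p q" "block_rel i m R q r"
  then show "block_rel i m R p r"
    unfolding block_rel_def using tree_rel_trans[OF assms(1)] by blast
next
  fix p q r assume "block_rel i m R p r" "p < q" "q < r"
  then show "block_rel i m R q r"
    unfolding block_rel_def
    using tree_rel_interval[OF assms(1), of "p + i - 1" "r + i - 1" "q + i - 1"] assms(2) by auto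
qed

text \<open>
  Positions other than \<open>i\<close> have a single preimage, so compositions at them lift to \<open>R\<close>; compositions at
  \<open>i\<close> were added. Two of the added pairs never compose, since each goes from before \<open>i\<close> to after it.
\<close>

lemma tree_rel_contract_rel:
  assumes R: "tree_rel (n + m - 1) R" and i: "1 \<le> i" "i \<le> n" and m: "1 \<le> m"
  shows "tree_rel n (contract_rel i m R)"
proof -
  let ?F = "fuse_rel i m R"
  have rng: "1 \<le> x \<and> x < y \<and> y \<le> n" if F: "?F x y" for x y
  proof -
    obtain p q where pq: "R p q" "x = fuse i m p" "y = fuse i m q" "x \<noteq> y"
      using F by (auto simp: fuse_rel_def)
    have "1 \<le> p" "p < q" "q \<le> n + m - 1" using tree_rel_range[OF R pq(1)] by auto
    then show ?thesis
      using pq fuse_mono[of p q i m] fuse_range[of i m p] fuse_range'[of i n m q] i m by auto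
  qed
  have tr: "?F x z" if F: "?F x y" "?F y z" "y \<noteq> i" for x y z
  proof -
    obtain p q where pq1: "R p q" "x = fuse i m p" "y = fuse i m q"
      using F(1) unfolding fuse_rel_def by blast
    obtain q' r where pq2: "R q' r" "y = fuse i m q'" "z = fuse i m r"
      using F(2) unfolding fuse_rel_def by blast
    note pq = pq1 pq2
    have "q = q'" using pq F(3) fuse_eq_iff[OF m] fuse_eq_block_iff[OF m] by metis
    then have "R p r" using pq tree_rel_trans[OF R] by blast
    then show ?thesis using pq rng[OF that(1)] rng[OF that(2)] unfolding fuse_rel_def by fastforce
  qed
  have iv: "?F y z" if F: "?F x z" "x < y" "y < z" for x y z
  proof -
    obtain p r where pr: "R p r" "x = fuse i m p" "z = fuse i m r"
      using F by (auto simp: fuse_rel_def)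
    obtain q where q: "y = fuse i m q" using fuse_surj[OF m] by metis
    have "p < q" "q < r" using that pr q fuse_less_imp_less by blast+
    then have "R q r" using tree_rel_interval[OF R pr(1)] by blast
    then show ?thesis using that pr q unfolding fuse_rel_def by blast
  qed
  show ?thesis
    unfolding tree_rel_def
  proof (intro conjI allI impI)
    fix x y assume "contract_rel i m R x y"
    then show "1 \<le> x" "x < y" "y \<le> n"
      using rng[of x y] rng[of x i] rng[of i y] unfolding contract_rel_def by auto
  next
    fix x y z assume "contract_rel i m R x y" "contract_rel i m R y z"
    then show "contract_rel i m R x z"
      unfolding contract_rel_def using rng tr by (metis less_asym)
  next
    fix x y z assume *: "contract_rel i m R x z" "x < y" "y < z"
    then consider "?F x z" | "?F x i" "?F i z" unfolding contract_rel_def by blast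
    then show "contract_rel i m R y z"
    proof cases
      case 1
      then show ?thesis using iv * unfolding contract_rel_def by blast
    next
      case 2
      then show ?thesis using iv[of x i y] iv[of i z y] * unfolding contract_rel_def
        by (metis linorder_neqE_nat)
    qed
  qed
qed

text \<open>
  The description of \<open>tree_comp\<close> imposes on \<open>s\<close> and \<open>t\<close> separate lower bounds. The side condition there
  is automatic: if a node before the block lies below \<open>q\<close> in \<open>r\<close>, so does the first node of the block.
\<close>

lemma tree_comp_le_iff_rel:
  assumes i: "1 \<le> i" "i \<le> size s" and m: "1 \<le> size t"
    and r: "size r = size s + size t - 1"
  shows "tree_comp i s t \<le> r \<longleftrightarrow>
    (\<forall>x y. contract_rel i (size t) (left_desc r) x y \<longrightarrow> left_desc s x y) \<and>
    (\<forall>p q. block_rel i (size t) (left_desc r) p q \<longrightarrow> left_desc t p q)"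
    (is "_ \<longleftrightarrow> ?C \<and> ?D")
proof -
  note comp = left_desc_tree_comp[OF i m]
  have "tree_comp i s t \<le> r \<longleftrightarrow> (\<forall>p q. left_desc r p q \<longrightarrow> left_desc (tree_comp i s t) p q)"
    using size_tree_comp[OF i m] r by (simp add: tamari_iff)
  also have "\<dots> \<longleftrightarrow> ?C \<and> ?D"
  proof (intro iffI conjI allI impI)
    assume B: "\<forall>p q. left_desc r p q \<longrightarrow> left_desc (tree_comp i s t) p q"
    have F: "left_desc s x y" if F: "fuse_rel i (size t) (left_desc r) x y" for x y
    proof -
      obtain p q where pq: "left_desc r p q" "x = fuse i (size t) p" "y = fuse i (size t) q" "x \<noteq> y"
        using F by (auto simp: fuse_rel_def)
      then have "\<not> (i \<le> p \<and> p < i + size t \<and> i \<le> q \<and> q < i + size t)"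
        using fuse_eq_iff[OF m] by metis
      then show ?thesis using B[rule_format, OF pq(1)] pq(2,3) unfolding comp by simp
    qed
    show "left_desc s x y" if "contract_rel i (size t) (left_desc r) x y" for x y
      using that F left_desc_trans unfolding contract_rel_def by blast
    show "left_desc t p q" if "block_rel i (size t) (left_desc r) p q" for p q
    proof -
      have pq: "1 \<le> p" "q \<le> size t" "left_desc r (p + i - 1) (q + i - 1)"
        using that by (auto simp: block_rel_def)
      have "p < q" using left_desc_range[OF pq(3)] by auto
      then show ?thesis
        using B[rule_format, OF pq(3)] pq i unfolding comp by (auto split: if_splits)
    qed
  next
    fix p q assume CD: "?C \<and> ?D" and r: "left_desc r p q"
    have pq: "p < q" using left_desc_range[OF r] by auto
    have blk: "left_desc t (p' + 1 - i) (q' + 1 - i)"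
      if "left_desc r p' q'" "i \<le> p'" "q' < i + size t" for p' q'
    proof -
      have "block_rel i (size t) (left_desc r) (p' + 1 - i) (q' + 1 - i)"
        using that i left_desc_range[OF that(1)] unfolding block_rel_def by auto
      then show ?thesis using CD by blast
    qed
    show "left_desc (tree_comp i s t) p q"
    proof (cases "i \<le> p \<and> p < i + size t \<and> i \<le> q \<and> q < i + size t")
      case True
      then show ?thesis unfolding comp using blk[OF r] by simp
    next
      case False
      then have "fuse i (size t) p \<noteq> fuse i (size t) q" using pq by (simp add: fuse_eq_iff[OF m])
      then have "fuse_rel i (size t) (left_desc r) (fuse i (size t) p) (fuse i (size t) q)"
        using r unfolding fuse_rel_def by blast
      then have "left_desc s (fuse i (size t) p) (fuse i (size t) q)"
        using CD unfolding contract_rel_def by blast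
      moreover have "left_desc t 1 (q + 1 - i)" if "p < i" "i \<le> q" "q < i + size t" "q \<noteq> i"
        using blk[OF left_desc_interval[OF r, of i]] that by simp
      ultimately show ?thesis unfolding comp using False by auto
    qed
  qed
  finally show ?thesis .
qed

definition tree_of :: "nat \<Rightarrow> (nat \<Rightarrow> nat \<Rightarrow> bool) \<Rightarrow> btree" where
  "tree_of n R = (THE t. size t = n \<and> left_desc t = R)"

lemma tree_of:
  assumes "tree_rel n R"
  shows "size (tree_of n R) = n" "left_desc (tree_of n R) = R"
proof -
  have "\<exists>!t. size t = n \<and> left_desc t = R"
    using tree_rel_realized[OF assms] left_desc_inj by auto
  from theI'[OF this] show "size (tree_of n R) = n" "left_desc (tree_of n R) = R"
    unfolding tree_of_def by auto
qed

text \<open>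
  The factors of \<open>r\<close> are the largest trees whose composition lies below \<open>r\<close>.
\<close>

definition outer_factor :: "nat \<Rightarrow> nat \<Rightarrow> nat \<Rightarrow> btree \<Rightarrow> btree" where
  "outer_factor n m i r = tree_of n (contract_rel i m (left_desc r))"

definition inner_factor :: "nat \<Rightarrow> nat \<Rightarrow> btree \<Rightarrow> btree" where
  "inner_factor m i r = tree_of m (block_rel i m (left_desc r))"

lemma outer_factor:
  assumes "1 \<le> i" "i \<le> n" "1 \<le> m" "size r = n + m - 1"
  shows "size (outer_factor n m i r) = n" "left_desc (outer_factor n m i r) = contract_rel i m (left_desc r)"
  unfolding outer_factor_def using tree_of[OF tree_rel_contract_rel[of n m "left_desc r" i]]
    tree_rel_left_desc[of r] assms by simp_all

lemma inner_factor:
  assumes "1 \<le> i"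
  shows "size (inner_factor m i r) = m" "left_desc (inner_factor m i r) = block_rel i m (left_desc r)"
  unfolding inner_factor_def using tree_of[OF tree_rel_block_rel[OF tree_rel_left_desc[of r] assms]]
  by simp_all

theorem tree_comp_le_iff:
  assumes i: "1 \<le> i" "i \<le> size s" and m: "1 \<le> size t"
    and r: "size r = size s + size t - 1"
  shows "tree_comp i s t \<le> r \<longleftrightarrow> s \<le> outer_factor (size s) (size t) i r \<and> t \<le> inner_factor (size t) i r"
proof -
  have "s \<le> outer_factor (size s) (size t) i r \<longleftrightarrow>
      (\<forall>x y. contract_rel i (size t) (left_desc r) x y \<longrightarrow> left_desc s x y)"
    using outer_factor[OF i m r] by (simp add: tamari_iff)
  moreover have "t \<le> inner_factor (size t) i r \<longleftrightarrow>
      (\<forall>p q. block_rel i (size t) (left_desc r) p q \<longrightarrow> left_desc t p q)"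
    using inner_factor[OF i(1)] by (simp add: tamari_iff)
  ultimately show ?thesis using tree_comp_le_iff_rel[OF assms] by simp
qed

lemma fuse_cases:
  assumes "1 \<le> m" "p < q"
  obtains (block) "i \<le> p" "q < i + m" | (diff) "fuse i m p < fuse i m q"
  using assms fuse_eq_iff[of m i p q] fuse_mono[of p q i m] by (metis le_less nat_less_le)

text \<open>
  The left subtree of \<open>y\<close> contains \<open>i\<close> and starts where that of \<open>i\<close> starts (at \<open>i\<close>
  itself if that is empty). These are the nodes met when climbing from \<open>i\<close> as long as one climbs
  from left children.
\<close>

definition same_reach :: "btree \<Rightarrow> nat \<Rightarrow> nat \<Rightarrow> bool" where
  "same_reach s i y \<longleftrightarrow> left_desc s i y \<and> (\<forall>x<i. left_desc s x y \<longrightarrow> left_desc s x i)"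

text \<open>
  Which relations a tree \<open>r\<close> above \<open>tree_comp i s t\<close> must have in order to have factors \<open>s\<close> and \<open>t\<close>. The
  relations within the block are forced. A relation of \<open>s\<close> from the left to \<open>i\<close> needs some witness in
  the block, and if there is one, the root of \<open>t\<close>, where \<open>gam t\<close> is maximal, is one as well.
  For \<open>y\<close> with the reach of \<open>i\<close> one witness in the block suffices, and the position of the entry 1
  serves; every other \<open>y\<close> with \<open>i\<close> in its left subtree has left descendants before the block outside
  the left subtree of \<open>i\<close>, hence the whole block below it. Finally, a relation across the block need not
  be present in \<open>r\<close> if composition at \<open>i\<close> supplies it.
\<close>

definition top_rel :: "nat \<Rightarrow> btree \<Rightarrow> btree \<Rightarrow> nat \<Rightarrow> nat \<Rightarrow> bool" where
  "top_rel i s t p q \<longleftrightarrow> (let x = fuse i (size t) p; y = fuse i (size t) q in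
    if x = y then left_desc t (p + 1 - i) (q + 1 - i)
    else left_desc s x y \<and> (x < i \<and> y = i \<longrightarrow> gam t ! (q - i) = int (size t)) \<and>
      (x = i \<and> same_reach s i y \<longrightarrow> gam t ! (p - i) = 1) \<and> \<not> (x < i \<and> same_reach s i y))"

lemma ex_gam_nth:
  assumes "1 \<le> v" "v \<le> int (size t)"
  obtains k where "k < size t" "gam t ! k = v"
proof -
  have "v \<in> set (gam t)" using assms by (simp add: set_gam)
  then show ?thesis using that by (auto simp: in_set_conv_nth)
qed

text \<open>
  Since \<open>r\<close> is above the composition, its factors are at least \<open>s\<close> and \<open>t\<close>, and equality means that the
  contraction and the restriction of \<open>left_desc r\<close> contain \<open>left_desc s\<close> and \<open>left_desc t\<close>. One direction
  finds a preimage satisfying \<open>top_rel\<close> for each pair of \<open>s\<close> that is not a composition at \<open>i\<close>; the other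
  moves an arbitrary preimage in the block to the one that \<open>top_rel\<close> prescribes.
\<close>

theorem top_rel_le_iff:
  assumes i: "1 \<le> i" "i \<le> size s" and m: "1 \<le> size t"
    and r: "size r = size s + size t - 1"
    and B: "tree_comp i s t \<le> r"
  shows "(\<forall>p q. 1 \<le> p \<longrightarrow> p < q \<longrightarrow> q \<le> size r \<longrightarrow> top_rel i s t p q \<longrightarrow> left_desc r p q) \<longleftrightarrow>
    s = outer_factor (size s) (size t) i r \<and> t = inner_factor (size t) i r"
proof -
  let ?m = "size t" and ?n = "size s"
  let ?f = "fuse i ?m"
  let ?F = "fuse_rel i ?m (left_desc r)"
  let ?C = "contract_rel i ?m (left_desc r)"
  let ?D = "block_rel i ?m (left_desc r)"
  have C: "\<And>x y. ?C x y \<Longrightarrow> left_desc s x y" and D: "\<And>p q. ?D p q \<Longrightarrow> left_desc t p q"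
    using tree_comp_le_iff_rel[OF i m r] B by auto
  have outer_iff: "s = outer_factor ?n ?m i r \<longleftrightarrow> (\<forall>x y. left_desc s x y \<longrightarrow> ?C x y)"
  proof -
    have "s = outer_factor ?n ?m i r \<longleftrightarrow> left_desc s = ?C"
      using left_desc_inj[of s "outer_factor ?n ?m i r"] outer_factor[OF i m r] by metis
    then show ?thesis using C by (auto simp: fun_eq_iff)
  qed
  have inner_iff: "t = inner_factor ?m i r \<longleftrightarrow> (\<forall>p q. left_desc t p q \<longrightarrow> ?D p q)"
  proof -
    have "t = inner_factor ?m i r \<longleftrightarrow> left_desc t = ?D"
      using left_desc_inj[of t "inner_factor ?m i r"] inner_factor[OF i(1), of ?m r] by metis
    then show ?thesis using D by (auto simp: fun_eq_iff)
  qed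
  have unf: "\<exists>p. ?f p = x \<and> 1 \<le> p \<and> p \<le> size r" if "1 \<le> x" "x \<le> ?n" for x
    using that i m r
    by (intro exI[of _ "if x \<le> i then x else x + ?m - 1"]) (auto simp: fuse_def)
  have nth_uniq: "k = l" if "gam t ! k = gam t ! l" "k < ?m" "l < ?m" for k l
    using that distinct_gam[of t] by (simp add: nth_eq_iff_index_eq)
  obtain kt where kt: "kt < ?m" "gam t ! kt = int ?m"
    using ex_gam_nth[of "int ?m" t] m by auto
  obtain kb where kb: "kb < ?m" "gam t ! kb = 1"
    using ex_gam_nth[of 1 t] m by auto
  \<comment> \<open>A node before the block that lies below some node of the block lies below the root, at \<open>kt + 1\<close>; if
    some node of the block lies below a later node, so does the one with the least entry, at \<open>kb + 1\<close>.\<close>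
  have below_top: "left_desc t (k + 1) (kt + 1)" if "k < kt" for k
    using gam_less_iff[of "k + 1" "kt + 1" t] gam_nth_range[of "k + 1" t] that kt nth_uniq[of k kt]
    by (auto simp: less_le)
  have bot_below: "left_desc t (kb + 1) (k + 1)" if "kb < k" "k < ?m" for k
    using gam_less_iff[of "kb + 1" "k + 1" t] gam_nth_range[of "k + 1" t] that kb nth_uniq[of k kb]
    by (auto simp: less_le)
  have not_top_below: "\<not> left_desc t (kt + 1) q" for q
  proof
    assume a: "left_desc t (kt + 1) q"
    note rq = left_desc_range[OF a]
    then show False using gam_less_iff[of "kt + 1" q t] gam_nth_range[of q t] a kt by auto
  qed
  show ?thesis unfolding outer_iff inner_iff
  proof (intro iffI conjI allI impI)
    assume T: "\<forall>p q. 1 \<le> p \<longrightarrow> p < q \<longrightarrow> q \<le> size r \<longrightarrow> top_rel i s t p q \<longrightarrow> left_desc r p q"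
    show "?D p q" if "left_desc t p q" for p q
    proof -
      have rng: "1 \<le> p" "p < q" "q \<le> ?m" using left_desc_range[OF that] by auto
      have "?f (p + i - 1) = i" "?f (q + i - 1) = i" using rng i by (auto simp: fuse_def)
      then have "top_rel i s t (p + i - 1) (q + i - 1)" using that i by (simp add: top_rel_def)
      then have "left_desc r (p + i - 1) (q + i - 1)" using T rng i r by simp
      then show ?thesis using rng by (simp add: block_rel_def)
    qed
    have F: "?F x y" if "left_desc s x y" "top_rel i s t p q" "?f p = x" "?f q = y"
      "1 \<le> p" "q \<le> size r" for x y p q
    proof -
      have "x < y" using left_desc_range[OF that(1)] by auto
      then have "p < q" using that fuse_less_imp_less by blast
      then have "left_desc r p q" using T that by blast
      then show ?thesis using \<open>x < y\<close> that unfolding fuse_rel_def by blast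
    qed
    have Fi: "?F x i" if "left_desc s x i" for x
    proof -
      have x: "1 \<le> x" "x < i" "x \<noteq> i" using left_desc_range[OF that] by auto
      have f: "?f x = x" "?f (i + kt) = i" using x kt by (auto simp: fuse_def)
      show ?thesis
        by (rule F[OF that _ f]) (use x f that kt i r in \<open>auto simp: top_rel_def same_reach_def dest: left_desc_range\<close>)
    qed
    have Fi': "?F i y" if "left_desc s i y" for y
    proof -
      have y: "i < y" "y \<le> ?n" using left_desc_range[OF that] by auto
      have f: "?f (i + kb) = i" "?f (y + ?m - 1) = y" using y kb m by (auto simp: fuse_def)
      show ?thesis
        by (rule F[OF that _ f]) (use y f that kb i r in \<open>auto simp: top_rel_def\<close>)
    qed
    show "?C x y" if s: "left_desc s x y" for x y
    proof (cases "x = i \<or> y = i")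
      case True
      then show ?thesis using Fi Fi' s by (auto simp: contract_rel_def)
    next
      case False
      have xy: "1 \<le> x" "x < y" "y \<le> ?n" using left_desc_range[OF s] by auto
      show ?thesis
      proof (cases "x < i \<and> same_reach s i y")
        case True
        then have "left_desc s x i" "left_desc s i y" using s by (auto simp: same_reach_def)
        then show ?thesis using Fi Fi' by (auto simp: contract_rel_def)
      next
        case no: False
        obtain p q where pq: "?f p = x" "?f q = y" "1 \<le> p" "q \<le> size r"
          using unf[of x] unf[of y] xy by auto
        have "top_rel i s t p q" using no False xy s pq by (simp add: top_rel_def)
        then show ?thesis using F[OF s _ pq] by (simp add: contract_rel_def)
      qed
    qed
  next
    fix p q
    assume CD: "(\<forall>x y. left_desc s x y \<longrightarrow> ?C x y) \<and> (\<forall>p q. left_desc t p q \<longrightarrow> ?D p q)"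
      and pq: "1 \<le> p" "p < q" "q \<le> size r" and T: "top_rel i s t p q"
    have D': "left_desc r (i + k) (i + l)" if "left_desc t (k + 1) (l + 1)" for k l
    proof -
      have "?D (k + 1) (l + 1)" using CD that by blast
      then show ?thesis by (simp add: block_rel_def add.commute)
    qed
    have C': "?C x y" if "left_desc s x y" for x y using CD that by blast
    have uniq: "p1 = p2" if "?f p1 = ?f p2" "?f p2 \<noteq> i" for p1 p2
      using that fuse_eq_iff[OF m] fuse_eq_block_iff[OF m] by metis
    have pull: "left_desc r p1 q1" if "?F (?f p1) (?f q1)" "?f p1 \<noteq> i" "?f q1 \<noteq> i" for p1 q1
      using that uniq unfolding fuse_rel_def by metis
    have Fs: "?F x y \<Longrightarrow> left_desc s x y" for x y using C by (auto simp: contract_rel_def)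
    have F_irrefl: "\<not> ?F x x" for x by (simp add: fuse_rel_def)
    \<comment> \<open>A node reaching further to the left than \<open>i\<close> has in \<open>r\<close> a left descendant before the block: the
      relation of \<open>s\<close> that witnesses this is no composition at \<open>i\<close>, so it comes from \<open>r\<close> itself.\<close>
    have over_block: "\<exists>z<i. left_desc r z q1 \<and> \<not> left_desc s z i"
      if y: "left_desc s i (?f q1)" and nr: "\<not> same_reach s i (?f q1)" for q1
    proof -
      obtain z where z: "z < i" "left_desc s z (?f q1)" "\<not> left_desc s z i"
        using y nr by (auto simp: same_reach_def)
      have "?F z (?f q1)" using C'[OF z(2)] z(3) Fs by (auto simp: contract_rel_def)
      moreover have "?f z = z" using z(1) by (simp add: fuse_def)
      moreover have "?f q1 \<noteq> i" using left_desc_range[OF y] by auto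
      ultimately have "left_desc r z q1" using pull[of z q1] z(1) by auto
      then show ?thesis using z by blast
    qed
    show "left_desc r p q"
      using m pq(2)
    proof (cases rule: fuse_cases[where i = i])
      case block
      then have "?f p = i" "?f q = i" using pq by (auto simp: fuse_def)
      then have "left_desc t (p - i + 1) (q - i + 1)"
        using T block pq by (simp add: top_rel_def Suc_diff_le)
      from D'[OF this] show ?thesis using block pq by simp
    next
      case diff
      have s: "left_desc s (?f p) (?f q)" using T diff by (simp add: top_rel_def Let_def)
      consider "?f q = i" | "?f p = i" | "?f p \<noteq> i" "?f q \<noteq> i" by blast
      then show ?thesis
      proof cases
        case 1
        have "gam t ! (q - i) = int ?m" using T diff 1 by (simp add: top_rel_def Let_def)
        moreover have "i \<le> q" "q < i + ?m" using 1 fuse_eq_block_iff[OF m] by auto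
        ultimately have q: "q = i + kt" using nth_uniq[of "q - i" kt] kt by auto
        have "?F (?f p) i" using C'[OF s] 1 F_irrefl by (auto simp: contract_rel_def)
        then obtain p' k where k: "left_desc r p' k" "?f p' = ?f p" "?f k = i"
          unfolding fuse_rel_def by metis
        have "p' = p" using k diff 1 uniq by auto
        then have k: "left_desc r p k" "i \<le> k" "k < i + ?m"
          using k fuse_eq_block_iff[OF m] by auto
        have pi: "p < i" using diff 1 fuse_less_iff[OF m] by auto
        consider "k = i + kt" | "k < i + kt" | "k > i + kt" by linarith
        then show ?thesis
        proof cases
          case 1
          then show ?thesis using k q by simp
        next
          case 2
          then have "left_desc r k (i + kt)" using D'[OF below_top[of "k - i"]] k by auto
          then show ?thesis using left_desc_trans k q by blast
        next
          case 3
          have "left_desc r (i + kt) k" using left_desc_interval[OF k(1), of "i + kt"] 3 pi by simp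
          then have "?D (kt + 1) (k - i + 1)" using k i by (auto simp: block_rel_def add.commute)
          then show ?thesis using D not_top_below by blast
        qed
      next
        case 2
        have yi: "i < ?f q" using 2 diff by simp
        have q: "i + ?m \<le> q" using yi i m by (auto simp: fuse_def split: if_splits)
        have pb: "i \<le> p" "p < i + ?m" using 2 fuse_eq_block_iff[OF m] by auto
        have iy: "left_desc s i (?f q)" using s 2 by simp
        show ?thesis
        proof (cases "same_reach s i (?f q)")
          case True
          have "?F i (?f q)" using C'[OF iy] F_irrefl by (auto simp: contract_rel_def)
          then obtain k q' where k: "left_desc r k q'" "?f k = i" "?f q' = ?f q"
            unfolding fuse_rel_def by metis
          have "q' = q" using k yi uniq by auto
          then have "left_desc r k q" "k \<le> i + ?m - 1" using k fuse_eq_block_iff[OF m] by auto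
          then have l: "left_desc r (i + ?m - 1) q"
            using left_desc_interval[of r k q "i + ?m - 1"] q m by (cases "k = i + ?m - 1") auto
          have "gam t ! (p - i) = 1" using T diff 2 True by (simp add: top_rel_def Let_def)
          then have p: "p = i + kb" using nth_uniq[of "p - i" kb] kb pb by auto
          show ?thesis
          proof (cases "kb = ?m - 1")
            case True
            then show ?thesis using l p m by simp
          next
            case False
            then have "left_desc r (i + kb) (i + (?m - 1))"
              using D'[OF bot_below[of "?m - 1"]] kb by auto
            then show ?thesis using left_desc_trans l p m by fastforce
          qed
        next
          case False
          obtain z where z: "z < i" "left_desc r z q" using over_block[OF iy False] by blast
          then show ?thesis using left_desc_interval pb pq by (metis order_less_le_trans)
        qed
      next
        case 3
        show ?thesis
        proof (cases "?F (?f p) (?f q)")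
          case True
          then show ?thesis using pull 3 by blast
        next
          case False
          then have F: "?F (?f p) i" "?F i (?f q)" using C'[OF s] by (auto simp: contract_rel_def)
          then have xi: "left_desc s (?f p) i" and iy: "left_desc s i (?f q)" using Fs by auto
          have pi: "p < i" using left_desc_range[OF xi] fuse_less_iff[OF m] by auto
          then have fp: "?f p = p" by (simp add: fuse_def)
          have "\<not> same_reach s i (?f q)" using T diff fp pi by (simp add: top_rel_def Let_def)
          then obtain z where z: "z < i" "left_desc r z q" "\<not> left_desc s z i"
            using over_block[OF iy] by blast
          \<comment> \<open>Otherwise \<open>z\<close> would lie between \<open>p\<close> and \<open>i\<close> and belong to the left subtree of \<open>i\<close>.\<close>
          have "z < p"
          proof (rule ccontr)
            assume "\<not> z < p"
            then show False using xi fp z left_desc_interval[of s p i z] by (cases "z = p") auto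
          qed
          then show ?thesis using left_desc_interval[OF z(2)] pq by blast
        qed
      qed
    qed
  qed
qed

section \<open>The permutation at the top of the interval\<close>

text \<open>
  Both lists have, at each position, the element of the common set with the same rank.
\<close>

lemma order_set_inj:
  fixes xs ys :: "int list"
  assumes "distinct xs" "distinct ys" "set xs = set ys" "length xs = length ys"
    and ord: "\<And>p q. p < length xs \<Longrightarrow> q < length xs \<Longrightarrow> xs ! p < xs ! q \<longleftrightarrow> ys ! p < ys ! q"
  shows "xs = ys"
proof (rule nth_equalityI)
  fix p assume p: "p < length xs"
  have rank: "card {v \<in> set zs. v < zs ! p} = card {q. q < length zs \<and> zs ! q < zs ! p}"
    if "distinct zs" for zs :: "int list"
  proof -
    have "{v \<in> set zs. v < zs ! p} = (!) zs ` {q. q < length zs \<and> zs ! q < zs ! p}"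
      by (auto simp: in_set_conv_nth)
    moreover have "inj_on ((!) zs) {q. q < length zs \<and> zs ! q < zs ! p}"
      using that by (auto simp: inj_on_def nth_eq_iff_index_eq)
    ultimately show ?thesis by (simp add: card_image)
  qed
  have "{q. q < length xs \<and> xs ! q < xs ! p} = {q. q < length ys \<and> ys ! q < ys ! p}"
    using ord p assms(4) by auto
  then have eq: "card {v \<in> set xs. v < xs ! p} = card {v \<in> set xs. v < ys ! p}"
    using rank assms by metis
  have mono: "card {v \<in> set xs. v < a} < card {v \<in> set xs. v < b}" if "a < b" "a \<in> set xs" for a b
    by (rule psubset_card_mono) (use that in auto)
  have "xs ! p \<in> set xs" "ys ! p \<in> set xs" using p assms by auto
  then show "xs ! p = ys ! p"
    using mono[of "xs ! p" "ys ! p"] mono[of "ys ! p" "xs ! p"] eq by fastforce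
qed (use assms in simp)

lemma st_order:
  assumes "distinct a"
  shows "length (st a) = length a"
    and "\<And>p q. p < length a \<Longrightarrow> q < length a \<Longrightarrow> st a ! p < st a ! q \<longleftrightarrow> a ! p < a ! q"
proof -
  let ?P = "\<lambda>\<sigma>. \<sigma> \<in> permutations_of_set {1..int (length a)} \<and>
    (\<forall>p < length a. \<forall>q < length a. \<sigma> ! p < \<sigma> ! q \<longleftrightarrow> a ! p < a ! q)"
  define rk where "rk x = int (card {w \<in> set a. w \<le> x})" for x
  have rk_mono: "rk x < rk y" if "x < y" "y \<in> set a" for x y
  proof -
    have "{w \<in> set a. w \<le> x} \<subset> {w \<in> set a. w \<le> y}"
    proof
      show "{w \<in> set a. w \<le> x} \<noteq> {w \<in> set a. w \<le> y}"
        using that by (metis (mono_tags, lifting) leD mem_Collect_eq order_refl)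
    qed (use that in auto)
    then show ?thesis by (simp add: rk_def psubset_card_mono)
  qed
  then have rk: "rk x < rk y \<longleftrightarrow> x < y" if "x \<in> set a" "y \<in> set a" for x y
    using that by (metis linorder_neqE not_less_iff_gr_or_eq)
  have "inj_on rk (set a)" using rk by (intro inj_onI) (metis linorder_neqE less_irrefl)
  then have d: "distinct (map rk a)" using assms by (simp add: distinct_map)
  have "1 \<le> rk x \<and> rk x \<le> int (length a)" if "x \<in> set a" for x
  proof -
    have "card {x} \<le> card {w \<in> set a. w \<le> x}" using that by (intro card_mono) auto
    moreover have "card {w \<in> set a. w \<le> x} \<le> card (set a)" by (intro card_mono) auto
    ultimately show ?thesis using distinct_card[OF assms] by (simp add: rk_def)
  qed
  then have "set (map rk a) \<subseteq> {1..int (length a)}" by auto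
  moreover have "card (set (map rk a)) = card {1..int (length a)}"
    using distinct_card[OF d] by simp
  ultimately have "set (map rk a) = {1..int (length a)}" by (intro card_subset_eq) auto
  then have "?P (map rk a)" using d rk by (auto intro!: permutations_of_setI)
  moreover have "\<sigma> = map rk a" if "?P \<sigma>" for \<sigma>
  proof (rule order_set_inj)
    show "length \<sigma> = length (map rk a)" using that length_finite_permutations_of_set by fastforce
    then show "\<sigma> ! p < \<sigma> ! q \<longleftrightarrow> map rk a ! p < map rk a ! q"
      if "p < length \<sigma>" "q < length \<sigma>" for p q
      using that \<open>?P \<sigma>\<close> \<open>?P (map rk a)\<close> by simp
  qed (use that \<open>?P (map rk a)\<close> in \<open>auto simp: permutations_of_set_def\<close>)
  ultimately have "?P (st a)" unfolding st_def by (rule theI)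
  then show "length (st a) = length a"
    and "\<And>p q. p < length a \<Longrightarrow> q < length a \<Longrightarrow> st a ! p < st a ! q \<longleftrightarrow> a ! p < a ! q"
    using length_finite_permutations_of_set by fastforce+
qed

lemma st_set_inj:
  assumes "distinct xs" "distinct ys" "st xs = st ys" "set xs = set ys"
  shows "xs = ys"
proof (rule order_set_inj[OF assms(1,2,4)])
  show len: "length xs = length ys" using st_order(1) assms by metis
  show "xs ! p < xs ! q \<longleftrightarrow> ys ! p < ys ! q" if "p < length xs" "q < length xs" for p q
    using st_order(2)[OF assms(1)] st_order(2)[OF assms(2)] that len assms(3) by metis
qed

lemma st_map_cong:
  assumes "\<And>x y. x \<in> set xs \<Longrightarrow> y \<in> set xs \<Longrightarrow> f x < f y \<longleftrightarrow> g x < (g y :: int)"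
  shows "st (map f xs) = st (map g xs)"
proof -
  have "(\<forall>p < length xs. \<forall>q < length xs. \<sigma> ! p < \<sigma> ! q \<longleftrightarrow> map f xs ! p < map f xs ! q) \<longleftrightarrow>
        (\<forall>p < length xs. \<forall>q < length xs. \<sigma> ! p < \<sigma> ! q \<longleftrightarrow> map g xs ! p < map g xs ! q)" for \<sigma> :: "int list"
    using assms by simp
  then show ?thesis unfolding st_def by simp
qed

text \<open>
  For \<open>v\<close> running over \<open>1, 2, \<dots>\<close>, the number \<open>k\<close> is the length of the initial run of values \<open>f v\<close> in \<open>A\<close>;
  the bound \<open>N\<close> in its definition is harmless since a run cannot be longer than \<open>card A\<close>.
\<close>

lemma Max_run:
  fixes f :: "int \<Rightarrow> int"
  assumes A: "finite A" "card A \<le> N" and f: "inj f"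
    and k: "k = Max {j \<in> {0..int N}. \<forall>v. 1 \<le> v \<and> v \<le> j \<longrightarrow> f v \<in> A}"
  shows "0 \<le> k" "\<And>v. 1 \<le> v \<Longrightarrow> v \<le> k \<Longrightarrow> f v \<in> A"
    and "\<And>j. (\<And>v. 1 \<le> v \<Longrightarrow> v \<le> j \<Longrightarrow> f v \<in> A) \<Longrightarrow> j \<le> k"
proof -
  let ?K = "{j \<in> {0..int N}. \<forall>v. 1 \<le> v \<and> v \<le> j \<longrightarrow> f v \<in> A}"
  have fin: "finite ?K" by (rule finite_subset[of _ "{0..int N}"]) auto
  have "0 \<in> ?K" by auto
  then have kK: "k \<in> ?K" unfolding k using Max_in[OF fin] by blast
  then show "0 \<le> k" "\<And>v. 1 \<le> v \<Longrightarrow> v \<le> k \<Longrightarrow> f v \<in> A" by auto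
  show "j \<le> k" if "\<And>v. 1 \<le> v \<Longrightarrow> v \<le> j \<Longrightarrow> f v \<in> A" for j
  proof (cases "0 \<le> j")
    case True
    have "card (f ` {1..j}) \<le> card A" using that A by (intro card_mono) auto
    moreover have "card (f ` {1..j}) = nat j"
      using f by (subst card_image) (auto intro: inj_on_subset)
    ultimately have "j \<in> ?K" using that True A(2) by auto
    then show ?thesis unfolding k using Max_ge[OF fin] by blast
  next
    case False
    then show ?thesis using \<open>0 \<le> k\<close> by simp
  qed
qed

text \<open>
  The entries of \<open>perm_T i (gam s) (gam t)\<close> to the left of the block, in the block and to its right, as
  functions of the entries \<open>x\<close> of \<open>gam s\<close> and \<open>gam t\<close>. Here \<open>c\<close> is the entry of \<open>gam s\<close> at position
  \<open>i\<close>, \<open>m\<close> is the size of \<open>t\<close>, and \<open>k\<close> and \<open>l\<close> are the lengths of the runs of values just below and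
  just above \<open>c\<close> that occur to the left and to the right of it.
\<close>

definition top_left :: "int \<Rightarrow> int \<Rightarrow> int \<Rightarrow> int \<Rightarrow> int" where
  "top_left c m l x = (if x < c then x + m - 1 + l else x + m - 1)"

definition top_block :: "int \<Rightarrow> int \<Rightarrow> int \<Rightarrow> int \<Rightarrow> int \<Rightarrow> int" where
  "top_block c m k l x = (if x = 1 then c - k else if x = m then c + m - 1 + l else x + c - 1 + l - k)"

definition top_right :: "int \<Rightarrow> int \<Rightarrow> int \<Rightarrow> int \<Rightarrow> int \<Rightarrow> int" where
  "top_right c m k l x = (if x < c then x else if x \<le> c + l then x - k else x + m - 1)"

lemma gam_split:
  assumes "1 \<le> i" "i \<le> size s"
  defines "c \<equiv> gam s ! (i - 1)"
  shows "gam s = take (i - 1) (gam s) @ c # drop i (gam s)"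
  using assms by (metis One_nat_def Suc_diff_le diff_Suc_1 id_take_nth_drop le_simps(2) length_gam less_eq_Suc_le)

text \<open>
  An entry of \<open>gam s\<close> before position \<open>i\<close> that is smaller than \<open>c\<close> belongs to the left subtree of \<open>i\<close>, and so
  do all values between it and \<open>c\<close>. Hence the run of length \<open>k\<close> comprises all smaller entries on the left,
  and the set called $A_{1,b}^\sigma$ is empty. The defining conditions of \<open>perm_T\<close> then hold for the list
  put together from three functions that are increasing on the respective entries, and they
  determine each of the three parts of the list.
\<close>

lemma perm_T_gam:
  assumes i: "1 \<le> i" "i \<le> size s" and m: "2 \<le> size t"
  defines "c \<equiv> gam s ! (i - 1)"
  obtains k l where "0 \<le> k" "0 \<le> l"
    "\<And>x. x \<in> set (take (i - 1) (gam s)) \<Longrightarrow> x < c \<Longrightarrow> c - k \<le> x"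
    "\<And>x. c - k \<le> x \<Longrightarrow> x < c \<Longrightarrow> x \<in> set (take (i - 1) (gam s))"
    "\<And>x. c < x \<Longrightarrow> x \<le> c + l \<Longrightarrow> x \<in> set (drop i (gam s))"
    "c + l + 1 \<notin> set (drop i (gam s))"
    "perm_T i (gam s) (gam t) = map (top_left c (size t) l) (take (i - 1) (gam s)) @
       map (top_block c (size t) k l) (gam t) @ map (top_right c (size t) k l) (drop i (gam s))"
proof -
  define n m' where "n = size s" and "m' = int (size t)"
  define xs zs where "xs = take (i - 1) (gam s)" and "zs = drop i (gam s)"
  define a where "a = (\<lambda>x. if x < c then x else x + int (size t) - 1)"
  have dec: "gam s = xs @ c # zs" using gam_split[OF i] by (simp add: xs_def zs_def c_def)
  have len: "length xs = i - 1" "length zs = n - i" using i by (simp_all add: xs_def zs_def n_def)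
  have dist: "distinct (xs @ c # zs)" using distinct_gam[of s] dec by simp
  have vals: "set xs \<union> {c} \<union> set zs = {1..int n}" using set_gam[of s] dec by (auto simp: n_def)
  have cn: "c \<le> int n" "1 \<le> c" using vals by auto
  have xs_rng: "1 \<le> x \<and> x \<le> int n" if "x \<in> set xs" for x
    using vals that by (metis UnI1 atLeastAtMost_iff)
  have all_vals: "v \<in> set xs \<or> v = c \<or> v \<in> set zs" if "1 \<le> v" "v \<le> int n" for v
    using vals that by (metis Un_iff atLeastAtMost_iff singletonD)
  have m2: "2 \<le> m'" using m by (simp add: m'_def)
  have B: "perm_comp i (gam s) (gam t) = map a xs @ map (\<lambda>x. x + c - 1) (gam t) @ map a zs"
    by (simp add: perm_comp_def Let_def a_def c_def xs_def zs_def)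
  have L1: "seq1 i (perm_comp i (gam s) (gam t)) = map a xs"
    and L2: "seq2 i (size t) (perm_comp i (gam s) (gam t)) = map (\<lambda>x. x + c - 1) (gam t)"
    and L3: "seq3 i (size t) (perm_comp i (gam s) (gam t)) = map a zs"
    unfolding B using len by (simp_all add: seq1_def seq2_def seq3_def)
  have a_low: "a x = x" if "x < c" for x using that by (simp add: a_def)
  have a_up: "a x = x + m' - 1" if "c \<le> x" for x using that by (simp add: a_def m'_def)
  define \<eta> where "\<eta> = c + int (size t) - 1"
  define k where "k = Max {j \<in> {0..int i - 1}. {c - j..c} \<subseteq> set (map a xs) \<union> {c}}"
  define l where "l = Max {j \<in> {0..int n - int i}. {\<eta>..\<eta> + j} \<subseteq> {\<eta>} \<union> set (map a zs)}"
  have inL1: "x \<in> a ` set xs \<longleftrightarrow> x \<in> set xs" if "x < c" for x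
    using that m2 unfolding a_def m'_def by (auto simp: image_iff) 
  have inL3: "x + m' - 1 \<in> a ` set zs \<longleftrightarrow> x \<in> set zs" if "x > c" for x
    using that m2 unfolding a_def m'_def by (auto simp: image_iff)
  have kM: "k = Max {j \<in> {0..int (i - 1)}. \<forall>v. 1 \<le> v \<and> v \<le> j \<longrightarrow> c - v \<in> a ` set xs}"
  proof -
    have "{c - j..c} \<subseteq> a ` set xs \<union> {c} \<longleftrightarrow> (\<forall>v. 1 \<le> v \<and> v \<le> j \<longrightarrow> c - v \<in> a ` set xs)" for j
    proof
      assume *: "\<forall>v. 1 \<le> v \<and> v \<le> j \<longrightarrow> c - v \<in> a ` set xs"
      show "{c - j..c} \<subseteq> a ` set xs \<union> {c}"
      proof
        fix x assume "x \<in> {c - j..c}"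
        then show "x \<in> a ` set xs \<union> {c}" using *[rule_format, of "c - x"] by (cases "x = c") auto
      qed
    next
      assume *: "{c - j..c} \<subseteq> a ` set xs \<union> {c}"
      show "\<forall>v. 1 \<le> v \<and> v \<le> j \<longrightarrow> c - v \<in> a ` set xs"
      proof (intro allI impI)
        fix v assume "1 \<le> v \<and> v \<le> j"
        then show "c - v \<in> a ` set xs" using subsetD[OF *, of "c - v"] by auto
      qed
    qed
    then show ?thesis unfolding k_def using i by (simp add: of_nat_diff)
  qed
  have lM: "l = Max {j \<in> {0..int (n - i)}. \<forall>v. 1 \<le> v \<and> v \<le> j \<longrightarrow> \<eta> + v \<in> a ` set zs}"
  proof -
    have "{\<eta>..\<eta> + j} \<subseteq> {\<eta>} \<union> a ` set zs \<longleftrightarrow> (\<forall>v. 1 \<le> v \<and> v \<le> j \<longrightarrow> \<eta> + v \<in> a ` set zs)" for j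
    proof
      assume *: "\<forall>v. 1 \<le> v \<and> v \<le> j \<longrightarrow> \<eta> + v \<in> a ` set zs"
      show "{\<eta>..\<eta> + j} \<subseteq> {\<eta>} \<union> a ` set zs"
      proof
        fix x assume "x \<in> {\<eta>..\<eta> + j}"
        then show "x \<in> {\<eta>} \<union> a ` set zs" using *[rule_format, of "x - \<eta>"] by (cases "x = \<eta>") auto
      qed
    next
      assume *: "{\<eta>..\<eta> + j} \<subseteq> {\<eta>} \<union> a ` set zs"
      show "\<forall>v. 1 \<le> v \<and> v \<le> j \<longrightarrow> \<eta> + v \<in> a ` set zs"
      proof (intro allI impI)
        fix v assume "1 \<le> v \<and> v \<le> j"
        then show "\<eta> + v \<in> a ` set zs" using subsetD[OF *, of "\<eta> + v"] by auto
      qed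
    qed
    then show ?thesis unfolding l_def using i by (simp add: of_nat_diff n_def)
  qed
  have cards: "card (a ` set xs) \<le> i - 1" "card (a ` set zs) \<le> n - i"
    using len by (metis card_length length_map list.set_map)+
  note K = Max_run[OF finite_imageI[OF finite_set] cards(1) _ kM]
    and L = Max_run[OF finite_imageI[OF finite_set] cards(2) _ lM]
  have inj: "inj (\<lambda>v. c - v)" "inj (\<lambda>v. \<eta> + v)" by (auto simp: inj_def)
  have k0: "0 \<le> k" and l0: "0 \<le> l" using K(1)[OF inj(1)] L(1)[OF inj(2)] by auto
  have low_in: "x \<in> set xs" if "c - k \<le> x" "x < c" for x
    using K(2)[OF inj(1), of "c - x"] that inL1[of x] by simp
  have up_in: "x \<in> set zs" if "c < x" "x \<le> c + l" for x
    using L(2)[OF inj(2), of "x - c"] that inL3[of x] by (simp add: \<eta>_def m'_def algebra_simps)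
  have up_max: "c + l + 1 \<notin> set zs"
  proof
    assume "c + l + 1 \<in> set zs"
    then have "x \<in> set zs" if "c < x" "x \<le> c + l + 1" for x using up_in[of x] that by (cases "x = c + l + 1") auto
    then have "\<eta> + v \<in> a ` set zs" if "1 \<le> v" "v \<le> l + 1" for v
      using inL3[of "c + v"] that by (simp add: \<eta>_def m'_def algebra_simps)
    then have "l + 1 \<le> l" by (rule L(3)[OF inj(2)])
    then show False by simp
  qed
  have low_run: "c - k \<le> x" if x: "x \<in> set xs" "x < c" for x
  proof -
    obtain p where p: "p < i - 1" "xs ! p = x" using x len by (auto simp: in_set_conv_nth)
    then have gp: "gam s ! p = x" by (simp add: xs_def)
    have pi: "left_desc s (p + 1) i" using gam_less_iff[of "p + 1" i s] p gp x i by (simp add: c_def)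
    have "y \<in> set xs" if y: "x \<le> y" "y < c" for y
    proof (rule ccontr)
      assume "y \<notin> set xs"
      then have "y \<in> set zs" using all_vals[of y] y xs_rng[OF x(1)] cn by auto
      then obtain q where q: "q < n - i" "zs ! q = y" using len by (auto simp: in_set_conv_nth)
      then have gq: "gam s ! (i + q) = y" using i by (simp add: zs_def n_def)
      have "x \<noteq> y" using \<open>y \<notin> set xs\<close> x by auto
      then have "left_desc s (p + 1) (i + q + 1)"
        using gam_less_iff[of "p + 1" "i + q + 1" s] p q gp gq y by (simp add: n_def)
      then have "left_desc s i (i + q + 1)" using left_desc_interval[of s "p + 1" _ i] p by simp
      moreover have "i + q + 1 \<le> size s" using q by (simp add: n_def)
      ultimately have "c < y" using gam_less_iff[of i "i + q + 1" s] gq i by (simp add: c_def)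
      then show False using y by simp
    qed
    then have "c - v \<in> a ` set xs" if "1 \<le> v" "v \<le> c - x" for v
      using that inL1[of "c - v"] by simp
    then have "c - x \<le> k" by (rule K(3)[OF inj(1)])
    then show ?thesis by simp
  qed
  let ?g1 = "top_left c m' l" and ?g2 = "top_block c m' k l" and ?g3 = "top_right c m' k l"
  let ?\<rho> = "map ?g1 xs @ map ?g2 (gam t) @ map ?g3 zs"
  have xs_up: "c + l < x" if "x \<in> set xs" "c \<le> x" for x
    using that dist up_in[of x] by force
  have zs_low: "x < c - k" if "x \<in> set zs" "x \<le> c" for x
    using that dist low_in[of x] by force
  let ?A1b = "{x \<in> set (map a xs). x < c - k}" and ?A1t = "{x \<in> set (map a xs). x > c}"
    and ?A3b = "{x \<in> set (map a zs). x < \<eta>}" and ?A3t = "{x \<in> set (map a zs). x > \<eta> + l}"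
  let ?P = "\<lambda>\<rho>. \<rho> \<in> permutations_of_set {1..int (n + size t - 1)} \<and>
            st (seq1 i \<rho>) = st (map a xs) \<and>
            st (seq2 i (size t) \<rho>) = st (map (\<lambda>x. x + c - 1) (gam t)) \<and>
            st (seq3 i (size t) \<rho>) = st (map a zs) \<and>
            set (seq1 i \<rho>) = ?A1b \<union> {\<eta> + l - k..\<eta> + l - 1} \<union> ?A1t \<and>
            set (seq2 i (size t) \<rho>) = {c - k} \<union> {c - k + l + 1..\<eta> + l - k - 1} \<union> {\<eta> + l} \<and>
            set (seq3 i (size t) \<rho>) = ?A3b \<union> {c - k + 1..c - k + l} \<union> ?A3t"
  have seqs: "seq1 i ?\<rho> = map ?g1 xs" "seq2 i (size t) ?\<rho> = map ?g2 (gam t)" "seq3 i (size t) ?\<rho> = map ?g3 zs"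
    using len by (simp_all add: seq1_def seq2_def seq3_def)
  have "?P ?\<rho>" unfolding seqs
  proof (intro conjI)
    \<comment> \<open>It suffices that every value occurs, since the list has the length of a permutation. The cases
      follow the order of the value ranges of the three functions.\<close>
    have cover: "{1..int (n + size t - 1)} \<subseteq> set ?\<rho>"
    proof
      fix v assume v: "v \<in> {1..int (n + size t - 1)}"
      consider "v < c - k" | "v = c - k" | "c - k < v" "v \<le> c - k + l"
        | "c - k + l < v" "v < c - k + l + m' - 1" | "c - k + l + m' - 1 \<le> v" "v < \<eta> + l"
        | "v = \<eta> + l" | "v > \<eta> + l" by linarith
      then show "v \<in> set ?\<rho>"
      proof cases
        case 1
        then have "v \<in> set zs" using all_vals[of v] v cn low_run[of v] k0 by auto
        then show ?thesis using 1 k0 by (auto simp: top_right_def image_iff intro!: bexI[of _ v])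
      next
        case 2
        have "1 \<in> set (gam t)" using m2 by (simp add: set_gam m'_def)
        then show ?thesis using 2 by (auto simp: top_block_def image_iff intro!: bexI[of _ 1])
      next
        case 3
        then have "v + k \<in> set zs" using up_in by simp
        then show ?thesis using 3 by (auto simp: top_right_def image_iff intro!: bexI[of _ "v + k"])
      next
        case 4
        then have "v - c + 1 - l + k \<in> set (gam t)" by (simp add: set_gam m'_def)
        then show ?thesis using 4 by (auto simp: top_block_def image_iff intro!: bexI[of _ "v - c + 1 - l + k"])
      next
        case 5
        then have "v - m' + 1 - l \<in> set xs" using low_in[of "v - m' + 1 - l"] by (simp add: \<eta>_def m'_def)
        then show ?thesis using 5 by (auto simp: top_left_def \<eta>_def m'_def image_iff intro!: bexI[of _ "v - m' + 1 - l"])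
      next
        case 6
        have "m' \<in> set (gam t)" using m2 by (simp add: set_gam m'_def)
        then show ?thesis using 6 m2 by (auto simp: top_block_def \<eta>_def m'_def image_iff intro!: bexI[of _ m'])
      next
        case 7
        then have x: "v - m' + 1 > c + l" by (simp add: \<eta>_def m'_def)
        moreover have "1 \<le> v - m' + 1" "v - m' + 1 \<le> int n" using v x cn l0 m by (auto simp: m'_def)
        ultimately consider "v - m' + 1 \<in> set xs" | "v - m' + 1 \<in> set zs"
          using all_vals[of "v - m' + 1"] l0 by auto
        then show ?thesis
        proof cases
          case 1
          then show ?thesis using x l0 by (auto simp: top_left_def image_iff intro!: bexI[of _ "v - m' + 1"])
        next
          case 2
          then show ?thesis using x l0 by (auto simp: top_right_def image_iff intro!: bexI[of _ "v - m' + 1"])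
        qed
      qed
    qed
    have lenr: "length ?\<rho> = n + size t - 1" using len i by (simp add: n_def)
    have "card (set ?\<rho>) \<le> card {1..int (n + size t - 1)}" using card_length[of ?\<rho>] lenr by simp
    then have eq: "set ?\<rho> = {1..int (n + size t - 1)}" using cover card_seteq[of "set ?\<rho>"] by blast
    then have "distinct ?\<rho>" using lenr by (intro card_distinct) simp
    then show "?\<rho> \<in> permutations_of_set {1..int (n + size t - 1)}"
      using eq by (intro permutations_of_setI)
    show "st (map ?g1 xs) = st (map a xs)"
    proof (rule st_map_cong)
      fix x y assume "x \<in> set xs" "y \<in> set xs"
      then show "?g1 x < ?g1 y \<longleftrightarrow> a x < a y"
        using xs_up[of x] xs_up[of y] m2 l0 unfolding top_left_def a_def m'_def by auto
    qed
    show "st (map ?g2 (gam t)) = st (map (\<lambda>x. x + c - 1) (gam t))"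
    proof (rule st_map_cong)
      fix x y assume "x \<in> set (gam t)" "y \<in> set (gam t)"
      then show "?g2 x < ?g2 y \<longleftrightarrow> x + c - 1 < y + c - 1"
        using m2 l0 k0 unfolding top_block_def set_gam m'_def by auto
    qed
    show "st (map ?g3 zs) = st (map a zs)"
    proof (rule st_map_cong)
      fix x y assume "x \<in> set zs" "y \<in> set zs"
      then show "?g3 x < ?g3 y \<longleftrightarrow> a x < a y"
        using zs_low[of x] zs_low[of y] m2 l0 k0 unfolding top_right_def a_def m'_def by auto
    qed
    show "set (map ?g1 xs) = ?A1b \<union> {\<eta> + l - k..\<eta> + l - 1} \<union> ?A1t"
    proof -
      have "?A1b = {}" using inL1 low_run k0 by fastforce
      moreover have "?A1t = ?g1 ` {x \<in> set xs. c \<le> x}"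
      proof -
        have "?A1t = a ` {x \<in> set xs. c < a x}" by auto
        also have "{x \<in> set xs. c < a x} = {x \<in> set xs. c \<le> x}"
        proof -
          have "c < a x \<longleftrightarrow> c \<le> x" for x using a_low[of x] a_up[of x] m2 by (cases "x < c") auto
          then show ?thesis by simp
        qed
        also have "a ` {x \<in> set xs. c \<le> x} = ?g1 ` {x \<in> set xs. c \<le> x}"
          by (rule image_cong) (auto simp: a_up top_left_def)
        finally show ?thesis .
      qed
      moreover have "?g1 ` {x \<in> set xs. x < c} = {\<eta> + l - k..\<eta> + l - 1}"
      proof -
        have "{x \<in> set xs. x < c} = {c - k..c - 1}"
          by (auto intro: low_in dest: low_run)
        moreover have "?g1 ` {c - k..c - 1} = (\<lambda>x. x + (m' - 1 + l)) ` {c - k..c - 1}"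
          by (rule image_cong) (auto simp: top_left_def)
        ultimately show ?thesis
          unfolding image_add_atLeastAtMost' by (simp add: \<eta>_def m'_def algebra_simps)
      qed
      moreover have "set xs = {x \<in> set xs. x < c} \<union> {x \<in> set xs. c \<le> x}" by auto
      then have "set (map ?g1 xs) = ?g1 ` {x \<in> set xs. x < c} \<union> ?g1 ` {x \<in> set xs. c \<le> x}"
        by (metis image_Un list.set_map)
      ultimately show ?thesis by (simp only: Un_empty_left)
    qed
    show "set (map ?g2 (gam t)) = {c - k} \<union> {c - k + l + 1..\<eta> + l - k - 1} \<union> {\<eta> + l}"
    proof -
      have "{1..m'} = {1} \<union> {2..m' - 1} \<union> {m'}" using m2 by auto
      moreover have "?g2 ` {2..m' - 1} = {c - k + l + 1..\<eta> + l - k - 1}"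
      proof -
        have "?g2 ` {2..m' - 1} = (\<lambda>x. x + (c - 1 + l - k)) ` {2..m' - 1}"
          by (rule image_cong) (auto simp: top_block_def)
        then show ?thesis unfolding image_add_atLeastAtMost' by (simp add: \<eta>_def m'_def algebra_simps)
      qed
      moreover have "?g2 1 = c - k" "?g2 m' = \<eta> + l" using m2 by (auto simp: top_block_def \<eta>_def m'_def)
      ultimately show ?thesis
        by (simp only: list.set_map set_gam image_Un image_insert image_empty flip: m'_def)
    qed
    show "set (map ?g3 zs) = ?A3b \<union> {c - k + 1..c - k + l} \<union> ?A3t"
    proof -
      have "?A3b = ?g3 ` {x \<in> set zs. x < c}"
      proof -
        have "?A3b = a ` {x \<in> set zs. a x < \<eta>}" by auto
        also have "{x \<in> set zs. a x < \<eta>} = {x \<in> set zs. x < c}"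
        proof -
          have "a x < \<eta> \<longleftrightarrow> x < c" for x
            using a_low[of x] a_up[of x] m2 unfolding \<eta>_def m'_def by (cases "x < c") auto
          then show ?thesis by simp
        qed
        also have "a ` {x \<in> set zs. x < c} = ?g3 ` {x \<in> set zs. x < c}"
          by (rule image_cong) (auto simp: a_low top_right_def)
        finally show ?thesis .
      qed
      moreover have "?A3t = ?g3 ` {x \<in> set zs. c + l < x}"
      proof -
        have "?A3t = a ` {x \<in> set zs. \<eta> + l < a x}" by auto
        also have "{x \<in> set zs. \<eta> + l < a x} = {x \<in> set zs. c + l < x}"
        proof -
          have "\<eta> + l < a x \<longleftrightarrow> c + l < x" for x
            using a_low[of x] a_up[of x] m2 l0 unfolding \<eta>_def m'_def by (cases "x < c") auto
          then show ?thesis by simp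
        qed
        also have "a ` {x \<in> set zs. c + l < x} = ?g3 ` {x \<in> set zs. c + l < x}"
          by (rule image_cong) (use l0 in \<open>auto simp: a_up top_right_def\<close>)
        finally show ?thesis .
      qed
      moreover have "?g3 ` {x \<in> set zs. c < x \<and> x \<le> c + l} = {c - k + 1..c - k + l}"
      proof -
        have "{x \<in> set zs. c < x \<and> x \<le> c + l} = {c + 1..c + l}"
          by (auto intro: up_in)
        moreover have "?g3 ` {c + 1..c + l} = (\<lambda>x. x + (- k)) ` {c + 1..c + l}"
          by (rule image_cong) (auto simp: top_right_def)
        ultimately show ?thesis
          unfolding image_add_atLeastAtMost' by (simp add: algebra_simps)
      qed
      moreover have "x < c \<or> c < x \<and> x \<le> c + l \<or> c + l < x" if "x \<in> set zs" for x
        using that dist by auto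
      then have "set zs = {x \<in> set zs. x < c} \<union> {x \<in> set zs. c < x \<and> x \<le> c + l} \<union> {x \<in> set zs. c + l < x}"
        by blast
      then have "set (map ?g3 zs) = ?g3 ` {x \<in> set zs. x < c} \<union>
          ?g3 ` {x \<in> set zs. c < x \<and> x \<le> c + l} \<union> ?g3 ` {x \<in> set zs. c + l < x}"
        by (metis image_Un list.set_map)
      ultimately show ?thesis by (simp only:)
    qed
  qed
  have "perm_T i (gam s) (gam t) = (THE \<rho>. ?P \<rho>)"
    unfolding perm_T_def Let_def length_gam L1 L2 L3 c_def[symmetric]
    using m by (simp only: k_def l_def \<eta>_def n_def) simp
  also have "\<dots> = ?\<rho>"
  \<comment> \<open>Each part of the list is determined by its set of entries and its standardization.\<close>
  proof (rule the_equality)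
    fix \<rho> assume P: "?P \<rho>"
    have d: "distinct \<rho>" using P by (simp add: permutations_of_set_def)
    have d': "distinct ?\<rho>" using \<open>?P ?\<rho>\<close> unfolding permutations_of_set_def by blast
    have dd: "distinct (seq1 i \<rho>')" "distinct (seq2 i (size t) \<rho>')" "distinct (seq3 i (size t) \<rho>')"
      if "distinct \<rho>'" for \<rho>'
      using that by (simp_all add: seq1_def seq2_def seq3_def)
    have split: "\<rho>' = seq1 i \<rho>' @ seq2 i (size t) \<rho>' @ seq3 i (size t) \<rho>'" for \<rho>'
      unfolding seq1_def seq2_def seq3_def
      by (metis add.commute append_take_drop_id drop_drop)
    have "seq1 i \<rho> = seq1 i ?\<rho>"
      by (rule st_set_inj[OF dd(1)[OF d] dd(1)[OF d']]) (use P \<open>?P ?\<rho>\<close> in metis)+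
    moreover have "seq2 i (size t) \<rho> = seq2 i (size t) ?\<rho>"
      by (rule st_set_inj[OF dd(2)[OF d] dd(2)[OF d']]) (use P \<open>?P ?\<rho>\<close> in metis)+
    moreover have "seq3 i (size t) \<rho> = seq3 i (size t) ?\<rho>"
      by (rule st_set_inj[OF dd(3)[OF d] dd(3)[OF d']]) (use P \<open>?P ?\<rho>\<close> in metis)+
    ultimately show "\<rho> = ?\<rho>" using split[of \<rho>] split[of ?\<rho>] by metis
  qed (fact \<open>?P ?\<rho>\<close>)
  finally show ?thesis
    using that[of k l] k0 l0 low_run low_in up_in up_max unfolding xs_def zs_def m'_def by blast
qed

text \<open>
  Along increasing values, \<open>perm_T\<close> lists the entries on the right of the block below \<open>c - k\<close>, the minimum
  of the block, the ancestors of \<open>i\<close> with the same reach, the other entries of the block except its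
  maximum, the left subtree of \<open>i\<close>, the maximum of the block, and everything else. Reading off
  which of these precede each other in position gives \<open>top_rel\<close>.
\<close>

lemma noninv_perm_T:
  assumes i: "1 \<le> i" "i \<le> size s" and m: "2 \<le> size t"
    and p: "1 \<le> p" "p < q" "q \<le> size s + size t - 1"
  shows "noninv (perm_T i (gam s) (gam t)) p q \<longleftrightarrow> top_rel i s t p q"
proof -
  define n m' c where "n = size s" and "m' = int (size t)" and "c = gam s ! (i - 1)"
  define xs zs where "xs = take (i - 1) (gam s)" and "zs = drop i (gam s)"
  obtain k l where kl: "0 \<le> k" "0 \<le> l"
    and low_run: "\<And>x. x \<in> set xs \<Longrightarrow> x < c \<Longrightarrow> c - k \<le> x"
    and low_in: "\<And>x. c - k \<le> x \<Longrightarrow> x < c \<Longrightarrow> x \<in> set xs"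
    and up_in: "\<And>x. c < x \<Longrightarrow> x \<le> c + l \<Longrightarrow> x \<in> set zs"
    and up_max: "c + l + 1 \<notin> set zs"
    and \<rho>: "perm_T i (gam s) (gam t) =
      map (top_left c m' l) xs @ map (top_block c m' k l) (gam t) @ map (top_right c m' k l) zs"
    using perm_T_gam[OF i m] unfolding c_def m'_def xs_def zs_def by metis
  let ?\<rho> = "perm_T i (gam s) (gam t)"
  have dec: "gam s = xs @ c # zs" using gam_split[OF i] by (simp add: xs_def zs_def c_def)
  have len: "length xs = i - 1" "length zs = n - i" using i by (simp_all add: xs_def zs_def n_def)
  have dist: "distinct (xs @ c # zs)" using distinct_gam[of s] dec by simp
  have m2: "2 \<le> m'" using m by (simp add: m'_def)
  have lenr: "length ?\<rho> = n + size t - 1" unfolding \<rho> using len i by (simp add: n_def)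
  define \<sigma> where "\<sigma> x = gam s ! (x - 1)" for x
  have at_left: "?\<rho> ! (x - 1) = top_left c m' l (\<sigma> x)" if "1 \<le> x" "x < i" for x
  proof -
    have "x - 1 < i - 1" using that by simp
    then show ?thesis unfolding \<rho> \<sigma>_def using that len by (simp add: nth_append xs_def)
  qed
  have at_block: "?\<rho> ! (x - 1) = top_block c m' k l (gam t ! (x - i))" if "i \<le> x" "x < i + size t" for x
  proof -
    have "\<not> x - 1 < i - 1" "x - 1 - (i - 1) = x - i" "x - i < size t" using that i by auto
    then show ?thesis unfolding \<rho> using len by (simp only: nth_append length_map) simp
  qed
  have at_right: "?\<rho> ! (x - 1) = top_right c m' k l (\<sigma> (x + 1 - size t))"
    if "i + size t \<le> x" "x \<le> n + size t - 1" for x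
  proof -
    have "\<not> x - 1 < i - 1" "\<not> x - 1 - (i - 1) < size t" "x - 1 - (i - 1) - size t < n - i"
      "i + (x - 1 - (i - 1) - size t) = x + 1 - size t - 1" using that i m by (auto simp: n_def)
    then show ?thesis unfolding \<rho> \<sigma>_def using len
      by (simp only: nth_append length_map length_gam if_False nth_map)
        (simp only: zs_def nth_drop length_gam i n_def)
  qed
  have \<sigma>i: "\<sigma> i = c" by (simp add: \<sigma>_def c_def)
  have \<sigma>_left: "\<sigma> x \<in> set xs" if "1 \<le> x" "x < i" for x
  proof -
    have "\<sigma> x = xs ! (x - 1)" using that by (simp add: \<sigma>_def xs_def)
    then show ?thesis using that len by simp
  qed
  have \<sigma>_right: "\<sigma> y \<in> set zs" if "i < y" "y \<le> n" for y
  proof -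
    have "\<sigma> y = zs ! (y - 1 - i)" using that by (simp add: \<sigma>_def zs_def n_def)
    then show ?thesis using that len by simp
  qed
  have desc: "left_desc s x y \<longleftrightarrow> \<sigma> x < \<sigma> y" if "1 \<le> x" "x < y" "y \<le> n" for x y
    using gam_less_iff[of x y s] that by (simp add: \<sigma>_def n_def)
  have \<sigma>_inj: "\<sigma> x \<noteq> \<sigma> y" if "1 \<le> x" "x < y" "y \<le> n" for x y
    using that distinct_gam[of s] by (simp add: \<sigma>_def n_def nth_eq_iff_index_eq)
  have left_cases: "(c - k \<le> \<sigma> x \<and> \<sigma> x < c) \<or> c + l < \<sigma> x" if "1 \<le> x" "x < i" for x
    using \<sigma>_left[OF that] low_run[of "\<sigma> x"] up_in[of "\<sigma> x"] dist by force
  have right_cases: "\<sigma> y < c - k \<or> c < \<sigma> y" if "i < y" "y \<le> n" for y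
    using \<sigma>_right[OF that] low_in[of "\<sigma> y"] dist by force
  \<comment> \<open>In terms of values: no entry before position \<open>i\<close> lies between \<open>c\<close> and \<open>\<sigma> y\<close>.\<close>
  have reach: "same_reach s i y \<longleftrightarrow> c < \<sigma> y \<and> \<sigma> y \<le> c + l" if y: "i < y" "y \<le> n" for y
  proof
    assume R: "same_reach s i y"
    then have cy: "c < \<sigma> y" using desc[of i y] i y \<sigma>i by (simp add: same_reach_def)
    have "\<sigma> y \<le> c + l"
    proof (rule ccontr)
      assume no: "\<not> \<sigma> y \<le> c + l"
      have "1 \<le> c" "\<sigma> y \<le> int n"
        using gam_nth_range[of i s] gam_nth_range[of y s] i y by (auto simp: c_def \<sigma>_def n_def)
      then have "c + l + 1 \<in> set (gam s)" using no kl by (simp add: set_gam flip: n_def)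
      then have "c + l + 1 \<in> set xs" using up_max kl by (auto simp: dec)
      then obtain x where x: "x < i - 1" "xs ! x = c + l + 1" using len by (auto simp: in_set_conv_nth)
      then have sx: "\<sigma> (x + 1) = c + l + 1" by (simp add: \<sigma>_def xs_def)
      have "x + 1 < y" using x y by simp
      then have "left_desc s (x + 1) y" using desc[of "x + 1" y] \<sigma>_inj[of "x + 1" y] sx no y by auto
      then have "left_desc s (x + 1) i" using R x by (simp add: same_reach_def)
      moreover have "x + 1 < i" using x by simp
      ultimately show False using desc[of "x + 1" i] sx i kl \<sigma>i by (simp add: n_def)
    qed
    with cy show "c < \<sigma> y \<and> \<sigma> y \<le> c + l" by simp
  next
    assume R: "c < \<sigma> y \<and> \<sigma> y \<le> c + l"
    have "left_desc s x i" if x: "x < i" "left_desc s x y" for x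
    proof -
      have "1 \<le> x" using left_desc_range[OF x(2)] by simp
      then show ?thesis using desc[of x y] desc[of x i] left_cases[of x] x y i \<sigma>i R by (auto simp: n_def)
    qed
    then show "same_reach s i y" using desc[of i y] i y \<sigma>i R by (simp add: same_reach_def)
  qed
  have not_reach: "\<not> same_reach s i y" if "y \<le> i" for y
    using that left_desc_range[of s i y] by (auto simp: same_reach_def)
  have ni: "noninv ?\<rho> p q \<longleftrightarrow> ?\<rho> ! (p - 1) \<le> ?\<rho> ! (q - 1)"
    using p lenr by (simp add: noninv_def n_def)
  have inner_rng: "1 \<le> gam t ! (x - i)" "gam t ! (x - i) \<le> m'" if "i \<le> x" "x < i + size t" for x
    using gam_nth_range[of "x - i + 1" t] that by (simp_all add: m'_def)
  have fl: "fuse i (size t) x = x" if "x < i" for x using that by (simp add: fuse_def)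
  have fb: "fuse i (size t) x = i" if "i \<le> x" "x < i + size t" for x using that by (simp add: fuse_def)
  have fr: "fuse i (size t) x = x + 1 - size t" if "i + size t \<le> x" for x using that i by (auto simp: fuse_def)
  consider (LL) "q < i" | (LB) "p < i" "i \<le> q" "q < i + size t" | (LR) "p < i" "i + size t \<le> q"
    | (BB) "i \<le> p" "q < i + size t" | (BR) "i \<le> p" "p < i + size t" "i + size t \<le> q"
    | (RR) "i + size t \<le> p" by linarith
  then show ?thesis
  proof cases
    case LL
    have "top_rel i s t p q \<longleftrightarrow> \<sigma> p < \<sigma> q"
      using LL p i desc[of p q] not_reach[of q] by (simp add: top_rel_def fl n_def)
    moreover have "?\<rho> ! (p - 1) \<le> ?\<rho> ! (q - 1) \<longleftrightarrow> \<sigma> p < \<sigma> q"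
      using LL p i at_left[of p] at_left[of q] left_cases[of p] left_cases[of q] \<sigma>_inj[of p q] kl m2
      by (auto simp: top_left_def n_def)
    ultimately show ?thesis using ni by simp
  next
    case LB
    have "top_rel i s t p q \<longleftrightarrow> \<sigma> p < c \<and> gam t ! (q - i) = m'"
      using LB p i desc[of p i] not_reach[of i] by (simp add: top_rel_def fl fb n_def \<sigma>i m'_def)
    moreover have "?\<rho> ! (p - 1) \<le> ?\<rho> ! (q - 1) \<longleftrightarrow> \<sigma> p < c \<and> gam t ! (q - i) = m'"
      using LB p i at_left[of p] at_block[of q] left_cases[of p] inner_rng[of q] kl m2
      by (auto simp: top_left_def top_block_def n_def)
    ultimately show ?thesis using ni by simp
  next
    case LR
    define y where "y = q + 1 - size t"
    have y: "i < y" "y \<le> n" using LR p m i by (auto simp: y_def n_def)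
    have fq: "fuse i (size t) q = y" using LR fr by (simp add: y_def)
    have "top_rel i s t p q \<longleftrightarrow> \<sigma> p < \<sigma> y \<and> \<not> (c < \<sigma> y \<and> \<sigma> y \<le> c + l)"
      using LR p i y desc[of p y] reach[OF y] by (simp add: top_rel_def fl fq Let_def)
    moreover have "?\<rho> ! (p - 1) \<le> ?\<rho> ! (q - 1) \<longleftrightarrow> \<sigma> p < \<sigma> y \<and> \<not> (c < \<sigma> y \<and> \<sigma> y \<le> c + l)"
      using LR p i y at_left[of p] at_right[of q, folded y_def] left_cases[of p] right_cases[OF y] \<sigma>_inj[of p y] kl m2
      by (auto simp: top_left_def top_right_def n_def)
    ultimately show ?thesis using ni by simp
  next
    case BB
    have "top_rel i s t p q \<longleftrightarrow> gam t ! (p - i) < gam t ! (q - i)"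
      using BB p i gam_less_iff[of "p + 1 - i" "q + 1 - i" t] by (simp add: top_rel_def fb)
    moreover have "gam t ! (p - i) \<noteq> gam t ! (q - i)"
      using BB p distinct_gam[of t] by (simp add: nth_eq_iff_index_eq)
    then have "?\<rho> ! (p - 1) \<le> ?\<rho> ! (q - 1) \<longleftrightarrow> gam t ! (p - i) < gam t ! (q - i)"
      using BB p i at_block[of p] at_block[of q] inner_rng[of p] inner_rng[of q] kl m2
      by (auto simp: top_block_def)
    ultimately show ?thesis using ni by simp
  next
    case BR
    define y where "y = q + 1 - size t"
    have y: "i < y" "y \<le> n" using BR p m i by (auto simp: y_def n_def)
    have fq: "fuse i (size t) q = y" using BR fr by (simp add: y_def)
    have "top_rel i s t p q \<longleftrightarrow> c < \<sigma> y \<and> (\<sigma> y \<le> c + l \<longrightarrow> gam t ! (p - i) = 1)"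
      using BR p i y desc[of i y] reach[OF y] by (auto simp: top_rel_def fb fq Let_def \<sigma>i)
    moreover have "?\<rho> ! (p - 1) \<le> ?\<rho> ! (q - 1) \<longleftrightarrow> c < \<sigma> y \<and> (\<sigma> y \<le> c + l \<longrightarrow> gam t ! (p - i) = 1)"
      using BR p i y at_block[of p] at_right[of q, folded y_def] right_cases[OF y] inner_rng[of p] kl m2
      by (auto simp: top_block_def top_right_def n_def)
    ultimately show ?thesis using ni by simp
  next
    case RR
    define x y where "x = p + 1 - size t" and "y = q + 1 - size t"
    have xy: "i < x" "x < y" "y \<le> n" using RR p m i by (auto simp: x_def y_def n_def)
    have fp: "fuse i (size t) p = x" and fq: "fuse i (size t) q = y" using RR p fr by (simp_all add: x_def y_def)
    have "top_rel i s t p q \<longleftrightarrow> \<sigma> x < \<sigma> y"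
      using RR p i xy desc[of x y] by (simp add: top_rel_def fp fq Let_def)
    moreover have "?\<rho> ! (p - 1) \<le> ?\<rho> ! (q - 1) \<longleftrightarrow> \<sigma> x < \<sigma> y"
      using RR p i xy at_right[of p, folded x_def] at_right[of q, folded y_def] right_cases[of x] right_cases[of y] \<sigma>_inj[of x y] kl m2
      by (auto simp: top_right_def n_def)
    ultimately show ?thesis using ni by simp
  qed
qed

lemma size_one_tree: "size t = 1 \<Longrightarrow> t = Graft Leaf Leaf"
proof (cases t)
  case (Graft l r)
  assume "size t = 1"
  with Graft have "size l = 0" "size r = 0" by auto
  then show ?thesis using Graft by (cases l; cases r) auto
qed simp

lemma length_perm_T:
  assumes "1 \<le> i" "i \<le> size s" "1 \<le> size t"
  shows "length (perm_T i (gam s) (gam t)) = size s + size t - 1"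
proof (cases "size t = 1")
  case True
  then show ?thesis by (simp add: perm_T_def Let_def)
next
  case False
  then have "2 \<le> size t" using assms by simp
  then obtain k l where "perm_T i (gam s) (gam t) =
      map (top_left (gam s ! (i - 1)) (size t) l) (take (i - 1) (gam s)) @
      map (top_block (gam s ! (i - 1)) (size t) k l) (gam t) @
      map (top_right (gam s ! (i - 1)) (size t) k l) (drop i (gam s))"
    using perm_T_gam[OF assms(1,2)] by metis
  then show ?thesis using assms by simp
qed

text \<open>
  For \<open>size t = 1\<close> the permutation is \<open>gam s\<close> itself, composition with \<open>t\<close> is the identity and the
  interval is a single point. Otherwise the noninversions of \<open>perm_T\<close> are the pairs of \<open>top_rel\<close>.
\<close>

theorem tree_interval_iff:
  assumes i: "1 \<le> i" "i \<le> size s" and m: "1 \<le> size t"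
    and r: "size r = size s + size t - 1"
  shows "tree_comp i s t \<le> r \<and> r \<le> tree_T i s t \<longleftrightarrow>
    s = outer_factor (size s) (size t) i r \<and> t = inner_factor (size t) i r"
proof -
  note len = length_perm_T[OF i m]
  have le_T: "r \<le> tree_T i s t \<longleftrightarrow> (\<forall>p q. noninv (perm_T i (gam s) (gam t)) p q \<longrightarrow> left_desc r p q)"
    unfolding tree_T_def using le_varrho_iff[of r "perm_T i (gam s) (gam t)"] r len by simp
  have low: "tree_comp i s t \<le> r \<longleftrightarrow> s \<le> outer_factor (size s) (size t) i r \<and> t \<le> inner_factor (size t) i r"
    by (rule tree_comp_le_iff[OF i m r])
  show ?thesis
  proof (cases "size t = 1")
    \<comment> \<open>Composition with the tree of size 1 does nothing, hence the outer factor of \<open>r\<close> is \<open>r\<close>.\<close>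
    case True
    have comp: "tree_comp i u t = u" if "size u = size s" for u
    proof (rule left_desc_inj)
      show "size (tree_comp i u t) = size u" using size_tree_comp[of i u t] i that True by simp
      show "left_desc (tree_comp i u t) = left_desc u"
      proof (intro ext)
        fix p q
        have "fuse i (size t) x = x" for x using True by (auto simp: fuse_def)
        then show "left_desc (tree_comp i u t) p q = left_desc u p q"
          using left_desc_tree_comp[of i u t p q] i that True
            left_desc_range[of u i i] left_desc_range[of t 1 1]
          by (cases "p = i \<and> q = i") auto
      qed
    qed
    have t: "x = t" if "size x = 1" for x using size_one_tree that True by metis
    have inn: "t = inner_factor (size t) i r" using t inner_factor(1)[OF i(1)] True by metis
    have sr: "size r = size s" using r True by simp
    note out = outer_factor[OF i m r]
    have "u \<le> r \<longleftrightarrow> u \<le> outer_factor (size s) (size t) i r" if "size u = size s" for u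
      using tree_comp_le_iff[of i u t r] comp[OF that] i m r that inn by simp
    then have o: "outer_factor (size s) (size t) i r = r"
      using sr out(1) by (meson antisym order_refl)
    have "r \<le> tree_T i s t \<longleftrightarrow> r \<le> s"
      unfolding le_T using sr True by (simp add: perm_T_def Let_def tamari_iff noninv_gam)
    then show ?thesis using comp[of s] inn o by auto
  next
    case False
    then have m2: "2 \<le> size t" using m by simp
    show ?thesis
    proof (cases "tree_comp i s t \<le> r")
      case True
      have "r \<le> tree_T i s t \<longleftrightarrow>
        (\<forall>p q. 1 \<le> p \<longrightarrow> p < q \<longrightarrow> q \<le> size r \<longrightarrow> top_rel i s t p q \<longrightarrow> left_desc r p q)"
        unfolding le_T using noninv_perm_T[OF i m2] r len
        by (metis noninv_def)
      then show ?thesis using top_rel_le_iff[OF i m r True] True by simp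
    next
      case False
      then show ?thesis using low by auto
    qed
  qed
qed

section \<open>Moebius inversion\<close>

lemma mobius_sum:
  "(\<Sum>u \<in> {u. s \<le> u \<and> u \<le> t}. mobius s u) = (if s = t then 1 else 0)"
proof (cases "s \<le> t \<and> s \<noteq> t")
  case True
  have "finite {u. s \<le> u \<and> u < t}" by (rule finite_subset[OF _ finite_tamari_above[of s]]) auto
  moreover have "{u. s \<le> u \<and> u \<le> t} = insert t {u. s \<le> u \<and> u < t}" using True by auto
  moreover have "mobius s t = - (\<Sum>u \<in> {u. s \<le> u \<and> u < t}. mobius s u)"
    using True by (subst mobius.simps) simp
  ultimately show ?thesis using True by simp
next
  case False
  then show ?thesis
  proof (cases "s = t")
    case True
    then have "{u. s \<le> u \<and> u \<le> t} = {s}" by auto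
    then show ?thesis using True by (simp add: mobius.simps)
  next
    case False
    then have "{u. s \<le> u \<and> u \<le> t} = {}" using \<open>\<not> (s \<le> t \<and> s \<noteq> t)\<close> by auto
    then show ?thesis using False by (simp only: sum.empty) simp
  qed
qed

lemma scale_one: "scale 1 f = f"
  by (rule poly_mapping_eqI) (simp add: lookup_scale)

lemma scale_scale: "scale a (scale b f) = scale (a * b) f"
  by (rule poly_mapping_eqI) (simp add: lookup_scale mult.assoc)

lemma scale_sum_left: "scale (sum c A) f = (\<Sum>x \<in> A. scale (c x) f)"
  by (rule poly_mapping_eqI) (simp add: lookup_scale lookup_sum sum_distrib_right)

lemma scale_zero_left: "scale 0 f = 0"
  by (rule poly_mapping_eqI) (simp add: lookup_scale)

lemma mobius_sum_indicator:
  "(\<Sum>u \<in> {u. s \<le> u}. (of_int (mobius s u) :: 'k::comm_ring_1) * of_bool (u \<le> t)) = of_bool (s = t)"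
proof -
  have "(\<Sum>u \<in> {u. s \<le> u}. (of_int (mobius s u) :: 'k) * of_bool (u \<le> t)) =
      (\<Sum>u \<in> {u. s \<le> u \<and> u \<le> t}. of_int (mobius s u))"
    using finite_tamari_above[of s] by (intro sum.mono_neutral_cong_right) auto
  also have "\<dots> = of_int (\<Sum>u \<in> {u. s \<le> u \<and> u \<le> t}. mobius s u)" by simp
  finally show ?thesis by (simp add: mobius_sum)
qed

text \<open>
  The recursion for \<open>mobius\<close> runs over its second argument, whereas inverting the definition of \<open>M\<close>
  asks for sums over the first one. Induction from the top of the order avoids the dual recursion.
\<close>

lemma F_eq_sum_M: "(F s :: btree \<Rightarrow>\<^sub>0 'k::comm_ring_1) = (\<Sum>u \<in> {u. s \<le> u}. M u)"
proof (induction "card {u. s < u}" arbitrary: s rule: less_induct)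
  case less
  let ?up = "{u. s < u}"
  have fin: "finite ?up" by (rule finite_subset[OF _ finite_tamari_above[of s]]) auto
  have up: "{u. s \<le> u} = insert s ?up" by auto
  have IH: "(F t :: btree \<Rightarrow>\<^sub>0 'k) = (\<Sum>u \<in> ?up. scale (of_bool (t \<le> u)) (M u))" if "s < t" for t
  proof -
    have "{u. t < u} \<subset> ?up" using that by (auto intro: less_trans)
    then have "(F t :: btree \<Rightarrow>\<^sub>0 'k) = (\<Sum>u \<in> {u. t \<le> u}. M u)"
      using less fin by (simp add: psubset_card_mono)
    also have "\<dots> = (\<Sum>u \<in> ?up. scale (of_bool (t \<le> u)) (M u))"
      using that fin by (intro sum.mono_neutral_cong_left) (auto simp: scale_one scale_zero_left)
    finally show ?thesis .
  qed
  have "M s = F s + (\<Sum>t \<in> ?up. scale (of_int (mobius s t)) (F t :: btree \<Rightarrow>\<^sub>0 'k))"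
    unfolding M_def[of s] up using fin by (simp add: mobius.simps[of s s] scale_one)
  also have "(\<Sum>t \<in> ?up. scale (of_int (mobius s t)) (F t :: btree \<Rightarrow>\<^sub>0 'k)) =
      (\<Sum>t \<in> ?up. \<Sum>u \<in> ?up. scale (of_int (mobius s t) * of_bool (t \<le> u)) (M u))"
    by (intro sum.cong refl) (simp add: IH scale_sum scale_scale)
  also have "\<dots> = (\<Sum>u \<in> ?up. \<Sum>t \<in> ?up. scale (of_int (mobius s t) * of_bool (t \<le> u)) (M u))"
    by (rule sum.swap)
  \<comment> \<open>For \<open>u > s\<close> the sum of \<open>mobius s t\<close> over the whole of \<open>s \<le> t \<le> u\<close> vanishes, and the term for
    \<open>t = s\<close> is 1.\<close>
  also have "\<dots> = (\<Sum>u \<in> ?up. - M u)"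
  proof (intro sum.cong refl)
    fix u assume u: "u \<in> ?up"
    have "(\<Sum>t \<in> {t. s \<le> t}. (of_int (mobius s t) :: 'k) * of_bool (t \<le> u)) = 0"
      using u by (simp add: mobius_sum_indicator)
    then have "(\<Sum>t \<in> ?up. (of_int (mobius s t) :: 'k) * of_bool (t \<le> u)) = - 1"
      unfolding up using fin u by (simp add: mobius.simps[of s s] add_eq_0_iff less_imp_le)
    then have "(\<Sum>t \<in> ?up. scale (of_int (mobius s t) * of_bool (t \<le> u)) (M u)) =
        scale (- 1) (M u :: btree \<Rightarrow>\<^sub>0 'k)"
      by (simp flip: scale_sum_left)
    also have "\<dots> = - M u" by (rule poly_mapping_eqI) (simp add: lookup_scale)
    finally show "(\<Sum>t \<in> ?up. scale (of_int (mobius s t) * of_bool (t \<le> u)) (M u)) =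
        (- M u :: btree \<Rightarrow>\<^sub>0 'k)" .
  qed
  finally show ?case unfolding up using fin by (simp add: sum_negf)
qed

lemma circ_sum_left: "circ i (sum f A) g = (\<Sum>x \<in> A. circ i (f x) g)"
proof (induction A rule: infinite_finite_induct)
  case (insert x A)
  then show ?case by (simp add: circ_add_left)
qed (simp_all add: circ_def)

lemma circ_sum_right: "circ i f (sum g A) = (\<Sum>x \<in> A. circ i f (g x))"
proof (induction A rule: infinite_finite_induct)
  case (insert x A)
  then show ?case by (simp add: circ_add_right)
qed (simp_all add: circ_def)

theorem corollary4p6:
  fixes n m i :: nat and s t :: btree
  assumes "1 \<le> n" and "1 \<le> m"
    and "s \<in> Y n" and "t \<in> Y m"
    and "1 \<le> i" and "i \<le> n"
  shows "circ i (M s) (M t) =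
    (\<Sum>r \<in> {r \<in> Y (n + m - 1). tree_comp i s t \<le> r \<and> r \<le> tree_T i s t}.
       (M r :: btree \<Rightarrow>\<^sub>0 'k::comm_ring_1))"
proof -
  have sz: "size s = n" "size t = m" using assms by (auto simp: Y_def)
  let ?Y = "Y (n + m - 1)" and ?o = "outer_factor n m i" and ?i = "inner_factor m i"
  let ?\<mu> = "\<lambda>x y. of_int (mobius x y) :: 'k"
  have FB: "F (tree_comp i s' t') =
      (\<Sum>r \<in> ?Y. scale (of_bool (s' \<le> ?o r) * of_bool (t' \<le> ?i r)) (M r :: btree \<Rightarrow>\<^sub>0 'k))"
    if "s \<le> s'" "t \<le> t'" for s' t'
  proof -
    have sz': "size s' = n" "size t' = m" using that tamari_size sz by auto
    have "tree_comp i s' t' \<in> ?Y" using tree_comp_in_Y[of s' n t' m i] sz' assms by (simp add: Y_def)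
    then have sub: "{r. tree_comp i s' t' \<le> r} \<subseteq> ?Y" by (auto simp: Y_def dest: tamari_size)
    have "F (tree_comp i s' t') = (\<Sum>r \<in> {r. tree_comp i s' t' \<le> r}. (M r :: btree \<Rightarrow>\<^sub>0 'k))"
      by (rule F_eq_sum_M)
    also have "\<dots> = (\<Sum>r \<in> ?Y. scale (of_bool (tree_comp i s' t' \<le> r)) (M r))"
      using sub finite_Y by (intro sum.mono_neutral_cong_left) (auto simp: scale_one scale_zero_left)
    also have "\<dots> = (\<Sum>r \<in> ?Y. scale (of_bool (s' \<le> ?o r) * of_bool (t' \<le> ?i r)) (M r))"
      using tree_comp_le_iff[of i s' t'] sz' assms by (intro sum.cong refl) (simp add: Y_def of_bool_conj)
    finally show ?thesis .
  qed
  have "circ i (M s) (M t) = (\<Sum>s' \<in> {s'. s \<le> s'}. scale (?\<mu> s s') (circ i (F s') (M t)))"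
    by (simp add: M_def[of s] circ_sum_left circ_scale_left)
  also have "\<dots> = (\<Sum>s' \<in> {s'. s \<le> s'}. \<Sum>t' \<in> {t'. t \<le> t'}.
      scale (?\<mu> s s' * ?\<mu> t t') (F (tree_comp i s' t') :: btree \<Rightarrow>\<^sub>0 'k))"
    by (simp add: M_def[of t] circ_sum_right circ_scale_right circ_F scale_sum scale_scale)
  also have "\<dots> = (\<Sum>s' \<in> {s'. s \<le> s'}. \<Sum>t' \<in> {t'. t \<le> t'}. \<Sum>r \<in> ?Y.
      scale ((?\<mu> s s' * of_bool (s' \<le> ?o r)) * (?\<mu> t t' * of_bool (t' \<le> ?i r))) (M r))"
    by (intro sum.cong refl) (simp add: FB scale_sum scale_scale mult_ac)
  also have "\<dots> = (\<Sum>r \<in> ?Y. \<Sum>s' \<in> {s'. s \<le> s'}. \<Sum>t' \<in> {t'. t \<le> t'}.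
      scale ((?\<mu> s s' * of_bool (s' \<le> ?o r)) * (?\<mu> t t' * of_bool (t' \<le> ?i r))) (M r))"
    by (simp only: sum.swap[of _ ?Y])
  \<comment> \<open>The coefficient of each \<open>M r\<close> is a product of two Moebius sums.\<close>
  also have "\<dots> = (\<Sum>r \<in> ?Y. scale (of_bool (s = ?o r) * of_bool (t = ?i r)) (M r))"
    by (simp only: scale_sum_left[symmetric] sum_distrib_left[symmetric] sum_distrib_right[symmetric]
        mobius_sum_indicator)
  also have "\<dots> = (\<Sum>r \<in> ?Y. scale (of_bool (tree_comp i s t \<le> r \<and> r \<le> tree_T i s t)) (M r))"
    using tree_interval_iff[of i s t] sz assms by (intro sum.cong refl) (simp add: Y_def of_bool_conj)
  also have "\<dots> = (\<Sum>r \<in> {r \<in> ?Y. tree_comp i s t \<le> r \<and> r \<le> tree_T i s t}. M r)"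
    using finite_Y by (intro sum.mono_neutral_cong_right) (auto simp: scale_one scale_zero_left)
  finally show ?thesis .
qed

end
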